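(* Let $K$ and $K'$ be two homotopic (oriented) twisted knots with Gordian distance $d_G(K,K')$. Then there exist an integer $m\ge 0$ and $a_i\in\{-1,1\}$, $b_i,p_i^{0},p_i^{1}\in\{0,1\}$ for $i=1,\dots,m$ such that $$Q^{z}_{K}(s,t)-Q^{z}_{K'}(s,t)=\sum_{i=1}^{m}2\,a_i\bigl(s^{b_i}t^{p_i^{0}}-1\bigr)\bigl(s^{b_i}t^{p_i^{1}}-1\bigr)$$ and $$\sum_{i=1}^{m}|a_i|\le d_G(K,K').$$
   Context: Twisted knot diagrams. An oriented twisted knot diagram $K$ is a generic immersed oriented closed curve in $\mathbb{R}^2$ with finitely many transverse double points, each marked either as a classical crossing (with over/under information) or as a virtual crossing (no over/under information), together with finitely many bars (short transverse marks) on the curve away from the double points. Diagrams are considered up to planar isotopy. $C(K)$ is the set of classical crossings and $sgn(c)=sign(c)\in\{+1,-1\}$ is the usual sign of $c\in C(K)$. A twisted knot is an equivalence class of such diagrams under the Reidemeister moves $C_1,C_2,C_3,V_1,V_2,V_3,V_4,T_1,T_2,T_3$; $Q^z$ of a twisted knot is that of any diagram representing it. Reidemeister moves. $C_1,C_2,C_3$ are the usual classical Reidemeister moves; $V_1,V_2,V_3$ are the same moves with all crossings virtual; $V_4$ moves an arc having two consecutive virtual crossings across a classical crossing. $T_1$ inserts or deletes two adjacent bars on an arc. $T_2$ slides a bar along its strand through a virtual crossing. $T_3$ replaces a classical crossing $c$ having a bar on each of its four adjacent arcs (one before and one after $c$ on each strand) by a bar-free tangle with the same end points and the same connectivity in which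 the two strands cross first virtually, then at one classical crossing $c'$, then again virtually; the strand that is over at $c$ is under at $c'$, and $sgn(c')=sgn(c)$. All orientations are allowed. Homotopy and Gordian distance. A crossing change at $c\in C(K)$ exchanges the over and under strands at $c$ and leaves the rest of the diagram unchanged. Two twisted knots are homotopic if diagrams of them are related by a finite sequence of crossing changes and the Reidemeister moves $C_1,C_2,C_3,V_1,V_2,V_3,V_4,T_1,T_2,T_3$. For homotopic $K,K'$, the Gordian distance $d_G(K,K')$ is the minimum number of crossing changes required to transform a diagram of $K$ into a diagram of $K'$ (Reidemeister moves being allowed freely). Smoothing. For $c\in C(K)$, let $K_c$ be the two-component diagram obtained by the oriented smoothing at $c$, its components labelled $0$ and $1$ (which component gets which label does not affect the definitions of $ZC(K)$, $z$ and $Q^z$). Affine index. For $l\in\{0,1\}$, traverse the $l$-component of $K_c$ once along its orientation starting near $c$, and let $\gamma_1,\dots,\gamma_{k_l}$ be the sequence of classical crossings met (with repetition). Put $\epsilon_i=0$ if the traversal passes under at $\gamma_i$ and $\epsilon_i=1$ if it passes over. Then $ind^{\,l}(c,K)=\sum_{i=1}^{k_l}(-1)^{\epsilon_i}sign(\gamma_i)$. (Self-crossings of the $l$-component contribute zero, and $ind^{\,1}(c,K)=-ind^{\,0}(c,K)$.) Zero crossings. $c\in C(K)$ is a zero crossing if $ind^{\,l}(c,K)$ is even for $l=0$ or $1$ (equivalently both). $ZC(K)$ is the set of zero crossings. For $c\in ZC(K)$ the zero affine index is $zind^{\,l}(c,K)=\sum_{\gamma_i\in ZC(K)}(-1)^{\epsilon_i}sign(\gamma_i)$,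 the sum being over those terms of the sequence $\gamma_1,\dots,\gamma_{k_l}$ of classical crossings met along the $l$-component of $K_c$ that are zero crossings of $K$, and $z(c)\in\{0,1\}$ is the residue of $zind^{\,l}(c,K)$ mod $2$ (independent of $l$). Bar parity. For $c\in C(K)$, $p^l(c)\in\{0,1\}$ is the parity of the number of bars on the $l$-component of $K_c$. The polynomial. $$Q^{z}_{K}(s,t)=\sum_{c\in ZC(K)}sgn(c)\bigl(s^{z(c)}t^{p^{0}(c)}-1\bigr)\bigl(s^{z(c)}t^{p^{1}(c)}-1\bigr)+\sum_{c\in C(K)\setminus ZC(K)}sgn(c)\bigl(s\,t^{p^{0}(c)}-1\bigr)\bigl(s\,t^{p^{1}(c)}-1\bigr).$$ *)

theory Defs
  imports "HOL-Analysis.Analysis" "HOL-Computational_Algebra.Computational_Algebra"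
begin

section \<open>Oriented twisted knot diagrams\<close>

text \<open>
  The plane is the type of complex numbers, and a closed curve is a function on the reals of
  period 1. Over-passes and bars are recorded as sets of parameters, again closed under
  translation by 1. Double points that are not classical are the virtual crossings.
\<close>

record tdiag =
  crv  :: "real \<Rightarrow> complex"
  cls  :: "complex set"    \<comment> \<open>classical crossings, as points of the plane\<close>
  ups  :: "real set"       \<comment> \<open>parameters at which the curve passes over a classical crossing\<close>
  bars :: "real set"       \<comment> \<open>parameters of the bars\<close>

definition vel :: "tdiag \<Rightarrow> real \<Rightarrow> complex" where
  "vel K t = vector_derivative (crv K) (at t)"

text \<open>The determinant of two plane vectors: positive iff \<open>w\<close> points to the left of \<open>v\<close>.\<close>

definition turn :: "complex \<Rightarrow> complex \<Rightarrow> real" where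
  "turn v w = Im (cnj v * w)"

definition visits :: "tdiag \<Rightarrow> complex \<Rightarrow> real set" where
  "visits K p = {t \<in> {0..<1}. crv K t = p}"

definition dbl :: "tdiag \<Rightarrow> complex set" where
  "dbl K = {p. \<exists>u\<in>visits K p. \<exists>v\<in>visits K p. u \<noteq> v}"

definition twisted_diagram :: "tdiag \<Rightarrow> bool" where
  "twisted_diagram K \<longleftrightarrow>
     (\<forall>t. crv K (t + 1) = crv K t) \<and>
     crv K C1_differentiable_on UNIV \<and> (\<forall>t. vel K t \<noteq> 0) \<and>
     finite (dbl K) \<and> (\<forall>p\<in>dbl K. card (visits K p) = 2) \<and>
     (\<forall>p\<in>dbl K. \<forall>u\<in>visits K p. \<forall>v\<in>visits K p. u \<noteq> v \<longrightarrow> turn (vel K u) (vel K v) \<noteq> 0) \<and>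
     cls K \<subseteq> dbl K \<and>
     (\<forall>t. t + 1 \<in> ups K \<longleftrightarrow> t \<in> ups K) \<and> (\<forall>t\<in>ups K. crv K t \<in> cls K) \<and>
     (\<forall>p\<in>cls K. card (visits K p \<inter> ups K) = 1) \<and>
     (\<forall>t. t + 1 \<in> bars K \<longleftrightarrow> t \<in> bars K) \<and> finite (bars K \<inter> {0..<1}) \<and>
     (\<forall>t\<in>bars K. crv K t \<notin> dbl K)"

definition over_at :: "tdiag \<Rightarrow> complex \<Rightarrow> real" where
  "over_at K c = (THE t. t \<in> visits K c \<inter> ups K)"

definition under_at :: "tdiag \<Rightarrow> complex \<Rightarrow> real" where
  "under_at K c = (THE t. t \<in> visits K c - ups K)"

text \<open>Positive crossing: the under strand crosses the over strand from right to left.\<close>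

definition crossing_sign :: "tdiag \<Rightarrow> complex \<Rightarrow> int" where
  "crossing_sign K c = (if turn (vel K (over_at K c)) (vel K (under_at K c)) > 0 then 1 else - 1)"

section \<open>The polynomial\<close>

text \<open>
  If \<open>u < v\<close> are the two parameters of \<open>c\<close> in \<open>{0..<1}\<close>, the oriented smoothing at \<open>c\<close> joins
  each incoming branch to the outgoing branch of the other strand, so its two components are the
  closed-up arcs of the curve over \<open>{u<..<v}\<close> and \<open>{v<..<u+1}\<close>. They are labelled 0 and 1 in
  this order.
\<close>

definition component :: "tdiag \<Rightarrow> complex \<Rightarrow> nat \<Rightarrow> real set" where
  "component K c l =
     (let u = Min (visits K c); v = Max (visits K c)
      in if l = 0 then {u<..<v} else {v<..<u + 1})"

definition passes :: "tdiag \<Rightarrow> complex \<Rightarrow> nat \<Rightarrow> real set" where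
  "passes K c l = {t \<in> component K c l. crv K t \<in> cls K}"

definition eps :: "tdiag \<Rightarrow> real \<Rightarrow> nat" where
  "eps K t = (if t \<in> ups K then 1 else 0)"

definition aff_ind :: "tdiag \<Rightarrow> complex \<Rightarrow> nat \<Rightarrow> int" where
  "aff_ind K c l = (\<Sum>t\<in>passes K c l. (- 1) ^ eps K t * crossing_sign K (crv K t))"

definition ZC :: "tdiag \<Rightarrow> complex set" where
  "ZC K = {c \<in> cls K. \<exists>l\<in>{0, 1}. even (aff_ind K c l)}"

definition zind :: "tdiag \<Rightarrow> complex \<Rightarrow> nat \<Rightarrow> int" where
  "zind K c l =
     (\<Sum>t\<in>{t \<in> passes K c l. crv K t \<in> ZC K}. (- 1) ^ eps K t * crossing_sign K (crv K t))"

definition zres :: "tdiag \<Rightarrow> complex \<Rightarrow> nat" where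
  "zres K c = nat (zind K c 0 mod 2)"

definition bar_parity :: "tdiag \<Rightarrow> complex \<Rightarrow> nat \<Rightarrow> nat" where
  "bar_parity K c l = card (bars K \<inter> component K c l) mod 2"

text \<open>Polynomials in \<open>s\<close> and \<open>t\<close> with integer coefficients, as polynomials in \<open>t\<close> over \<open>\<int>[s]\<close>.\<close>

definition var_s :: "int poly poly" where "var_s = [:[:0, 1:]:]"
definition var_t :: "int poly poly" where "var_t = [:0, 1:]"

definition Qz :: "tdiag \<Rightarrow> int poly poly" where
  "Qz K =
     (\<Sum>c\<in>ZC K. of_int (crossing_sign K c) *
        (var_s ^ zres K c * var_t ^ bar_parity K c 0 - 1) *
        (var_s ^ zres K c * var_t ^ bar_parity K c 1 - 1)) +
     (\<Sum>c\<in>cls K - ZC K. of_int (crossing_sign K c) *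
        (var_s * var_t ^ bar_parity K c 0 - 1) *
        (var_s * var_t ^ bar_parity K c 1 - 1))"

section \<open>Planar isotopy\<close>

definition reparametrization :: "(real \<Rightarrow> real) \<Rightarrow> bool" where
  "reparametrization \<rho> \<longleftrightarrow>
     (\<forall>t. \<rho> (t + 1) = \<rho> t + 1) \<and> \<rho> C1_differentiable_on UNIV \<and>
     (\<forall>t. vector_derivative \<rho> (at t) > 0)"

definition ambient_isotopy ::
  "(real \<Rightarrow> complex \<Rightarrow> complex) \<Rightarrow> (real \<Rightarrow> complex \<Rightarrow> complex \<Rightarrow>\<^sub>L complex) \<Rightarrow> bool" where
  "ambient_isotopy H H' \<longleftrightarrow>
     H 0 = id \<and>
     continuous_on ({0..1} \<times> UNIV) (\<lambda>(s, x). H s x) \<and>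
     continuous_on ({0..1} \<times> UNIV) (\<lambda>(s, x). H' s x) \<and>
     (\<forall>s\<in>{0..1}. bij (H s) \<and>
        (\<forall>x. (H s has_derivative blinfun_apply (H' s x)) (at x) \<and> bij (blinfun_apply (H' s x))))"

definition isotopic :: "tdiag \<Rightarrow> tdiag \<Rightarrow> bool" where
  "isotopic K K' \<longleftrightarrow>
     (\<exists>H H' \<rho>. ambient_isotopy H H' \<and> reparametrization \<rho> \<and>
        K' = \<lparr>crv = H 1 \<circ> crv K \<circ> \<rho>, cls = H 1 ` cls K,
              ups = \<rho> -` ups K, bars = \<rho> -` bars K\<rparr>)"

section \<open>Reidemeister moves\<close>

text \<open>
  The moves C1--C3, V1--V4 and T3 replace the part of a diagram inside a round disk, where it
  consists of the \<open>n\<close> arcs over \<open>{a i<..<b i}\<close>, by another such part, all the rest being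
  unchanged. Up to isotopy and a shift of the base point every local replacement has this form.
\<close>

definition meets_disk :: "complex \<Rightarrow> real \<Rightarrow> nat \<Rightarrow> (nat \<Rightarrow> real) \<Rightarrow> (nat \<Rightarrow> real) \<Rightarrow> tdiag \<Rightarrow> bool" where
  "meets_disk z r n a b K \<longleftrightarrow>
     (\<forall>t\<in>{0..1}. crv K t \<in> ball z r \<longleftrightarrow> (\<exists>i<n. t \<in> {a i<..<b i})) \<and>
     (\<forall>t\<in>{0..1}. crv K t \<in> cball z r \<longleftrightarrow> (\<exists>i<n. t \<in> {a i..b i})) \<and>
     (\<forall>i<n. \<forall>t\<in>{a i, b i}. (crv K t - z) \<bullet> vel K t \<noteq> 0) \<and>
     dbl K \<inter> sphere z r = {}"

definition local_change ::
  "nat \<Rightarrow> (nat \<Rightarrow> real) \<Rightarrow> (nat \<Rightarrow> real) \<Rightarrow> tdiag \<Rightarrow> tdiag \<Rightarrow> bool" where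
  "local_change n a b K K' \<longleftrightarrow>
     (\<forall>i<n. 0 < a i \<and> a i < b i \<and> b i < 1) \<and>
     (\<forall>i<n. \<forall>j<n. i \<noteq> j \<longrightarrow> {a i..b i} \<inter> {a j..b j} = {}) \<and>
     (\<exists>z r. meets_disk z r n a b K \<and> meets_disk z r n a b K') \<and>
     (\<forall>t\<in>{0..1}. (\<forall>i<n. t \<notin> {a i<..<b i}) \<longrightarrow>
        crv K t = crv K' t \<and> (crv K t \<in> cls K \<longleftrightarrow> crv K' t \<in> cls K') \<and>
        (t \<in> ups K \<longleftrightarrow> t \<in> ups K') \<and> (t \<in> bars K \<longleftrightarrow> t \<in> bars K'))"

text \<open>Crossings of the arcs over \<open>A\<close> and \<open>B\<close>, as pairs of parameters.\<close>

definition meets :: "tdiag \<Rightarrow> real set \<Rightarrow> real set \<Rightarrow> (real \<times> real) set" where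
  "meets K A B = {(u, v). u \<in> A \<and> v \<in> B \<and> u \<noteq> v \<and> crv K u = crv K v}"

definition plain_arc :: "tdiag \<Rightarrow> real set \<Rightarrow> bool" where
  "plain_arc K A \<longleftrightarrow> meets K A A = {} \<and> bars K \<inter> A = {}"

abbreviation dir :: "tdiag \<Rightarrow> real \<Rightarrow> real \<Rightarrow> real" where
  "dir K u v \<equiv> sgn (turn (vel K u) (vel K v))"

text \<open>C1 (\<open>cl\<close> true) and V1 (\<open>cl\<close> false).\<close>

definition move1 :: "bool \<Rightarrow> tdiag \<Rightarrow> tdiag \<Rightarrow> bool" where
  "move1 cl K K' \<longleftrightarrow>
     (\<exists>a b u v. local_change 1 a b K K' \<and>
        (let A = {a 0<..<b 0} in
           plain_arc K A \<and> bars K' \<inter> A = {} \<and>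
           u < v \<and> meets K' A A = {(u, v), (v, u)} \<and> (crv K' u \<in> cls K' \<longleftrightarrow> cl)))"

text \<open>
  C2 and V2. The condition on \<open>dir\<close> (the second arc crosses the first one and then crosses back)
  is automatic: the end points are those of two disjoint arcs, so they are not interleaved.
\<close>

definition move2 :: "bool \<Rightarrow> tdiag \<Rightarrow> tdiag \<Rightarrow> bool" where
  "move2 cl K K' \<longleftrightarrow>
     (\<exists>a b u v u' v'. local_change 2 a b K K' \<and>
        (let A = {a 0<..<b 0}; B = {a 1<..<b 1} in
           plain_arc K A \<and> plain_arc K B \<and> plain_arc K' A \<and> plain_arc K' B \<and>
           meets K A B = {} \<and>
           u \<noteq> u' \<and> meets K' A B = {(u, v), (u', v')} \<and>
           (crv K' u \<in> cls K' \<longleftrightarrow> cl) \<and> (crv K' u' \<in> cls K' \<longleftrightarrow> cl) \<and>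
           (u \<in> ups K' \<longleftrightarrow> u' \<in> ups K') \<and>
           dir K' u v = - dir K' u' v'))"

text \<open>
  Moves with three arcs crossing pairwise once: each arc meets the other two in the opposite
  order before and after. \<open>u i j\<close> is the parameter on arc \<open>i\<close> of its crossing with arc \<open>j\<close>.
  The last condition is automatic, since it only depends on the end points of the arcs.
\<close>

definition triangle ::
  "(nat \<Rightarrow> real) \<Rightarrow> (nat \<Rightarrow> real) \<Rightarrow> (nat \<Rightarrow> nat \<Rightarrow> real) \<Rightarrow> tdiag \<Rightarrow> bool" where
  "triangle a b u K \<longleftrightarrow>
     (\<forall>i<3. plain_arc K {a i<..<b i}) \<and>
     (\<forall>i<3. \<forall>j<3. i \<noteq> j \<longrightarrow> meets K {a i<..<b i} {a j<..<b j} = {(u i j, u j i)})"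

definition triangle_move ::
  "(nat \<Rightarrow> nat \<Rightarrow> real) \<Rightarrow> (nat \<Rightarrow> nat \<Rightarrow> real) \<Rightarrow> tdiag \<Rightarrow> tdiag \<Rightarrow> bool" where
  "triangle_move u u' K K' \<longleftrightarrow>
     (\<exists>a b. local_change 3 a b K K' \<and> triangle a b u K \<and> triangle a b u' K') \<and>
     (\<forall>i<3. \<forall>j<3. \<forall>k<3. i \<noteq> j \<and> j \<noteq> k \<and> i \<noteq> k \<longrightarrow> (u i j < u i k \<longleftrightarrow> u' i k < u' i j)) \<and>
     (\<forall>i<3. \<forall>j<3. i \<noteq> j \<longrightarrow>
        (crv K (u i j) \<in> cls K \<longleftrightarrow> crv K' (u' i j) \<in> cls K') \<and>
        (u i j \<in> ups K \<longleftrightarrow> u' i j \<in> ups K') \<and>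
        dir K (u i j) (u j i) = dir K' (u' i j) (u' j i))"

text \<open>
  In C3 some arc lies over the other two (so the three arcs lie at different heights).
\<close>

definition move_C3 :: "tdiag \<Rightarrow> tdiag \<Rightarrow> bool" where
  "move_C3 K K' \<longleftrightarrow>
     (\<exists>u u'. triangle_move u u' K K' \<and>
        (\<forall>i<3. \<forall>j<3. i \<noteq> j \<longrightarrow> crv K (u i j) \<in> cls K) \<and>
        (\<exists>i<3. \<forall>j<3. i \<noteq> j \<longrightarrow> u i j \<in> ups K))"

definition move_V3 :: "tdiag \<Rightarrow> tdiag \<Rightarrow> bool" where
  "move_V3 K K' \<longleftrightarrow>
     (\<exists>u u'. triangle_move u u' K K' \<and>
        (\<forall>i<3. \<forall>j<3. i \<noteq> j \<longrightarrow> crv K (u i j) \<notin> cls K))"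

text \<open>The moving arc has number 2; the numbering of the arcs is arbitrary.\<close>

definition move_V4 :: "tdiag \<Rightarrow> tdiag \<Rightarrow> bool" where
  "move_V4 K K' \<longleftrightarrow>
     (\<exists>u u'. triangle_move u u' K K' \<and>
        crv K (u 0 1) \<in> cls K \<and> crv K (u 2 0) \<notin> cls K \<and> crv K (u 2 1) \<notin> cls K)"

definition translates :: "real \<Rightarrow> real set" where
  "translates u = {u + of_int k |k. True}"

definition move_T1 :: "tdiag \<Rightarrow> tdiag \<Rightarrow> bool" where
  "move_T1 K K' \<longleftrightarrow>
     (\<exists>u v. u < v \<and> v < u + 1 \<and> (\<forall>t\<in>{u..v}. crv K t \<notin> dbl K \<and> t \<notin> bars K) \<and>
        K' = K\<lparr>bars := bars K \<union> translates u \<union> translates v\<rparr>)"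

definition move_T2 :: "tdiag \<Rightarrow> tdiag \<Rightarrow> bool" where
  "move_T2 K K' \<longleftrightarrow>
     (\<exists>u w v. u < w \<and> w < v \<and> v < u + 1 \<and> crv K w \<in> dbl K - cls K \<and>
        (\<forall>t\<in>{u..v}. t \<noteq> w \<longrightarrow> crv K t \<notin> dbl K) \<and> bars K \<inter> {u..v} = {u} \<and>
        K' = K\<lparr>bars := (bars K - translates u) \<union> translates v\<rparr>)"

definition move_T3 :: "tdiag \<Rightarrow> tdiag \<Rightarrow> bool" where
  "move_T3 K K' \<longleftrightarrow>
     (\<exists>a b u v p p' q q' c c'. local_change 2 a b K K' \<and>
        (let A = {a 0<..<b 0}; B = {a 1<..<b 1} in
           meets K A A = {} \<and> meets K B B = {} \<and> plain_arc K' A \<and> plain_arc K' B \<and>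
           meets K A B = {(u, v)} \<and> crv K u \<in> cls K \<and>
           card (bars K \<inter> {a 0<..<u}) = 1 \<and> card (bars K \<inter> {u<..<b 0}) = 1 \<and>
           card (bars K \<inter> {a 1<..<v}) = 1 \<and> card (bars K \<inter> {v<..<b 1}) = 1 \<and>
           meets K' A B = {(p, p'), (c, c'), (q, q')} \<and>
           p < c \<and> c < q \<and> (p' < c' \<and> c' < q' \<or> q' < c' \<and> c' < p') \<and>
           crv K' p \<notin> cls K' \<and> crv K' c \<in> cls K' \<and> crv K' q \<notin> cls K' \<and>
           (c \<in> ups K' \<longleftrightarrow> u \<notin> ups K) \<and>
           crossing_sign K' (crv K' c) = crossing_sign K (crv K u)))"

definition reidemeister :: "tdiag \<Rightarrow> tdiag \<Rightarrow> bool" where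
  "reidemeister K K' \<longleftrightarrow> twisted_diagram K \<and> twisted_diagram K' \<and>
     (isotopic K K' \<or> (\<exists>cl. move1 cl K K') \<or> (\<exists>cl. move2 cl K K') \<or> move_C3 K K' \<or>
      move_V3 K K' \<or> move_V4 K K' \<or> move_T1 K K' \<or> move_T2 K K' \<or> move_T3 K K')"

section \<open>Twisted knots, homotopy and Gordian distance\<close>

definition twisted_knots :: "tdiag set set" where
  "twisted_knots =
     Collect twisted_diagram //
       {(D, D'). twisted_diagram D \<and> twisted_diagram D' \<and> equivclp reidemeister D D'}"

definition crossing_change :: "tdiag \<Rightarrow> tdiag \<Rightarrow> bool" where
  "crossing_change K K' \<longleftrightarrow>
     (\<exists>c\<in>cls K. K' = K\<lparr>ups := {t. if crv K t = c then t \<notin> ups K else t \<in> ups K}\<rparr>)"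

text \<open>\<open>transforms n D D'\<close>: Reidemeister moves and exactly \<open>n\<close> crossing changes lead from \<open>D\<close> to \<open>D'\<close>.\<close>

inductive transforms :: "nat \<Rightarrow> tdiag \<Rightarrow> tdiag \<Rightarrow> bool" where
  start: "twisted_diagram D \<Longrightarrow> transforms 0 D D"
| move: "transforms n D E \<Longrightarrow> symclp reidemeister E F \<Longrightarrow> transforms n D F"
| change: "transforms n D E \<Longrightarrow> crossing_change E F \<Longrightarrow> transforms (Suc n) D F"

definition homotopic_knots :: "tdiag set \<Rightarrow> tdiag set \<Rightarrow> bool" where
  "homotopic_knots K K' \<longleftrightarrow> (\<exists>D\<in>K. \<exists>D'\<in>K'. \<exists>n. transforms n D D')"

definition gordian_dist :: "tdiag set \<Rightarrow> tdiag set \<Rightarrow> nat" where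
  "gordian_dist K K' = (LEAST n. \<exists>D\<in>K. \<exists>D'\<in>K'. transforms n D D')"

end

theory Submission
  imports Defs
begin

text \<open>
  Every passage through a classical crossing contributes an odd number to an affine index, so the
  residues entering \<open>Q\<^sup>z\<close> are mere counts mod 2: of all classical passages, of the
  passages through zero crossings, and of the bars on an arc of the curve. These do not see
  which strand is over. Hence a crossing change affects only the sign of its own crossing, and
  changes \<open>Q\<^sup>z\<close> by twice one summand. Under a Reidemeister move inside a disk, every
  crossing outside keeps its counts because they change by an even number on each arc in the disk;
  for the crossings inside, the counts on the two strands change simultaneously. In a triangle move
  with three classical crossings the number of crossings that are not zero crossings is even,
  which is why the passages through zero crossings can be counted in the same way as all passages.
\<close>

section \<open>Summands of the polynomial\<close>

text \<open>The zero residue cannot be followed at crossings that are not zero crossings. If exactly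
  one corner of a triangle of classical crossings is a zero crossing, the triangle move changes, at
  each of the other two corners, the parity of the zero passages between the two strands.
  \<open>Qz\<close> gives those crossings the fixed exponent 1 of s, and the proof compares residues
  at zero crossings only. Since the residues are counted over \<open>ZC\<close>, the parities of all
  classical passages have to be settled before the zero passages can be compared at all.

  The other obstacle is the base point: it decides which component of a smoothing has label 0 and
  makes component 1 wrap around. Counting from the base point turns the parity on a component into a
  comparison of two values, one for each strand; the arcs of a local move avoid the base point, so
  each value can be followed separately. Only an isotopy can move the base point. It may exchange
  the two labels, which is harmless because the weight of a crossing is symmetric in its two bar
  parities.\<close>

text \<open>
  For a set \<open>X\<close> containing both or neither of \<open>u < v\<close>, the parity of the number of points of
  \<open>X\<close> between them is a symmetric function of \<open>low_odd X u\<close> and \<open>low_odd X v\<close>, so that the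
  order of the two strands at a crossing never matters.
\<close>

definition cpar :: "tdiag \<Rightarrow> complex set \<Rightarrow> real set" where
  "cpar K S = {t. crv K t \<in> S}"

definition low_odd :: "real set \<Rightarrow> real \<Rightarrow> bool" where
  "low_odd X t \<longleftrightarrow> odd (card (X \<inter> {0..<t}))"

definition wt :: "nat \<Rightarrow> nat \<Rightarrow> nat \<Rightarrow> int poly poly" where
  "wt b p q = (var_s ^ b * var_t ^ p - 1) * (var_s ^ b * var_t ^ q - 1)"

text \<open>The exponent of s in the summand of a crossing. The case distinction merges the two sums
  of \<open>Qz\<close> into a single sum over all classical crossings.\<close>

definition sdeg :: "tdiag \<Rightarrow> complex \<Rightarrow> nat" where
  "sdeg K c = (if c \<in> ZC K then zres K c else 1)"

definition cweight :: "tdiag \<Rightarrow> complex \<Rightarrow> int poly poly" where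
  "cweight K c = wt (sdeg K c) (bar_parity K c 0) (bar_parity K c 1)"

definition summand :: "tdiag \<Rightarrow> complex \<Rightarrow> int poly poly" where
  "summand K c = of_int (crossing_sign K c) * cweight K c"

lemma wt_commute: "wt b p q = wt b q p"
  by (simp add: wt_def mult.commute)

text \<open>This is what removes a kink: the loop cut off by the crossing of C1 meets no other
  crossing and carries no bar, so one of its two factors is 1 - 1.\<close>

lemma wt_0_0 [simp]: "wt 0 0 q = 0"
  by (simp add: wt_def)

section \<open>Parity counts of periodic sets of parameters\<close>

lemma even_sum_of_odd:
  fixes f :: "'a \<Rightarrow> int"
  assumes "finite A" "\<And>x. x \<in> A \<Longrightarrow> odd (f x)"
  shows "even (sum f A) \<longleftrightarrow> even (card A)"
proof -
  have "{x \<in> A. odd (f x)} = A" using assms by auto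
  then show ?thesis using assms(1) by (simp add: even_sum_iff)
qed

lemma periodic_int:
  fixes X :: "real set"
  assumes "\<And>t. t + 1 \<in> X \<longleftrightarrow> t \<in> X"
  shows "t + of_int k \<in> X \<longleftrightarrow> t \<in> X"
proof (induction k rule: int_induct[where k = 0])
  case base
  then show ?case by simp
next
  case (step1 i)
  then show ?case using assms[of "t + of_int i"] by (simp add: algebra_simps)
next
  case (step2 i)
  then show ?case using assms[of "t + of_int (i - 1)"] by (simp add: algebra_simps)
qed

lemma turn_swap: "turn w v = - turn v w"
  by (simp add: turn_def)

lemma split_unit:
  fixes X :: "real set"
  assumes per: "\<And>t. t + 1 \<in> X \<longleftrightarrow> t \<in> X" and fin: "finite (X \<inter> {0..<1})"
    and uv: "0 \<le> u" "u < v" "v < 1"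
  shows "finite (X \<inter> {v<..<u + 1})"
    and "card (X \<inter> {0..<1}) =
      card (X \<inter> {u<..<v}) + card (X \<inter> {v<..<u + 1}) + card (X \<inter> {u, v})"
proof -
  let ?f = "\<lambda>t::real. t + 1"
  \<comment> \<open>The interval runs past the base point. It is cut at 1, and what lies beyond is
    pulled back by one period.\<close>
  have eq: "X \<inter> {v<..<u + 1} = (X \<inter> {v<..<1}) \<union> ?f ` (X \<inter> {0..<u})"
  proof (intro equalityI subsetI)
    fix t assume t: "t \<in> X \<inter> {v<..<u + 1}"
    show "t \<in> (X \<inter> {v<..<1}) \<union> ?f ` (X \<inter> {0..<u})"
    proof (cases "t < 1")
      case False
      then have "t = ?f (t - 1)" "t - 1 \<in> X \<inter> {0..<u}" using t per[of "t - 1"] by auto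
      then show ?thesis by blast
    qed (use t in auto)
  qed (use per uv in auto)
  have f1: "finite (X \<inter> {v<..<1})" and f2: "finite (X \<inter> {0..<u})"
    and f3: "finite (X \<inter> {u<..<v})"
    using uv by (auto intro!: finite_subset[OF _ fin])
  then show "finite (X \<inter> {v<..<u + 1})" unfolding eq by simp
  have "card (X \<inter> {v<..<u + 1}) = card (X \<inter> {v<..<1}) + card (X \<inter> {0..<u})"
    unfolding eq using f1 f2 by (subst card_Un_disjoint) (auto simp: card_image)
  moreover have "X \<inter> {0..<1} =
      (X \<inter> {0..<u}) \<union> ((X \<inter> {u<..<v}) \<union> ((X \<inter> {v<..<1}) \<union> (X \<inter> {u, v})))"
    using uv by auto
  then have "card (X \<inter> {0..<1}) = card (X \<inter> {0..<u}) +
      (card (X \<inter> {u<..<v}) + (card (X \<inter> {v<..<1}) + card (X \<inter> {u, v})))"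
    using f1 f2 f3 uv by (simp only:) (subst card_Un_disjoint; (auto)[])+
  ultimately show "card (X \<inter> {0..<1}) =
      card (X \<inter> {u<..<v}) + card (X \<inter> {v<..<u + 1}) + card (X \<inter> {u, v})" by simp
qed

section \<open>Double points of one diagram and counts on the components of a smoothing\<close>

locale tw_diagram =
  fixes K :: tdiag
  assumes tw: "twisted_diagram K"
begin

lemma crv_periodic: "crv K (t + 1) = crv K t"
  using tw by (simp add: twisted_diagram_def)

lemma crv_shift: "crv K (t + of_int k) = crv K t"
  using periodic_int[of "crv K -` {crv K t}" t k] crv_periodic by simp

lemma cpar_periodic: "t + 1 \<in> cpar K S \<longleftrightarrow> t \<in> cpar K S"
  by (simp add: cpar_def crv_periodic)

lemma bars_periodic: "t + 1 \<in> bars K \<longleftrightarrow> t \<in> bars K"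
  and ups_periodic: "t + 1 \<in> ups K \<longleftrightarrow> t \<in> ups K"
  and finite_bars: "finite (bars K \<inter> {0..<1})"
  and cls_sub_dbl: "cls K \<subseteq> dbl K"
  and finite_dbl: "finite (dbl K)"
  and bars_not_dbl: "t \<in> bars K \<Longrightarrow> crv K t \<notin> dbl K"
  and ups_cls: "t \<in> ups K \<Longrightarrow> crv K t \<in> cls K"
  using tw by (auto simp: twisted_diagram_def)

lemma finite_cls: "finite (cls K)"
  using cls_sub_dbl finite_dbl finite_subset by blast

lemma differentiable: "(crv K has_vector_derivative vel K t) (at t)"
proof -
  have "crv K differentiable at t"
    using tw by (auto simp: twisted_diagram_def C1_differentiable_on_eq)
  then show ?thesis unfolding vel_def by (simp add: vector_derivative_works)
qed

lemma visits_of_pair: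
  assumes "u \<in> {0..<1}" "v \<in> {0..<1}" "u \<noteq> v" "crv K u = crv K v"
  shows "crv K u \<in> dbl K" "visits K (crv K u) = {u, v}"
proof -
  have uv: "{u, v} \<subseteq> visits K (crv K u)" using assms by (auto simp: visits_def)
  then show "crv K u \<in> dbl K" using assms(3) by (auto simp: dbl_def)
  then have c: "card (visits K (crv K u)) = 2"
    using tw by (auto simp: twisted_diagram_def)
  then have "finite (visits K (crv K u))" by (metis card.infinite zero_neq_numeral)
  with uv c assms(3) show "visits K (crv K u) = {u, v}"
    by (metis card_2_iff card_subset_eq)
qed

lemma dbl_visits:
  assumes "c \<in> dbl K"
  obtains u v where "visits K c = {u, v}" "u < v" "0 \<le> u" "v < 1" "crv K u = c" "crv K v = c"
proof -
  have "card (visits K c) = 2" using tw assms by (auto simp: twisted_diagram_def)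
  then obtain x y where xy: "visits K c = {x, y}" "x \<noteq> y" by (auto simp: card_2_iff)
  then have "x \<in> visits K c" "y \<in> visits K c" by auto
  then have m: "0 \<le> x" "x < 1" "crv K x = c" "0 \<le> y" "y < 1" "crv K y = c"
    by (auto simp: visits_def)
  show thesis
  proof (cases "x < y")
    case True
    then show ?thesis using that[of x y] xy m by auto
  next
    case False
    then show ?thesis using that[of y x] xy m by auto
  qed
qed

lemma cls_visits:
  assumes "c \<in> cls K"
  obtains u v where "visits K c = {u, v}" "u < v" "0 \<le> u" "v < 1" "crv K u = c" "crv K v = c"
  using dbl_visits assms cls_sub_dbl by blast

lemma finite_visits: "c \<in> cls K \<Longrightarrow> finite (visits K c)"
  by (metis cls_visits finite.emptyI finite.insertI)

lemma finite_cpar: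
  assumes "S \<subseteq> cls K"
  shows "finite (cpar K S \<inter> {0..<1})"
proof -
  have "cpar K S \<inter> {0..<1} = (\<Union>c\<in>S. visits K c)" by (auto simp: cpar_def visits_def)
  then show ?thesis using assms finite_cls finite_visits
    by (metis (no_types, lifting) finite_UN_I finite_subset subset_iff)
qed

text \<open>Every crossing in \<open>S\<close> is passed twice. As a consequence the two components
  of a smoothing have equal parities, so zero crossings and residues can be read off from component
  0 alone.\<close>

lemma even_card_cpar:
  assumes "S \<subseteq> cls K"
  shows "even (card (cpar K S \<inter> {0..<1}))"
proof -
  have fS: "finite S" using assms finite_cls finite_subset by blast
  have "cpar K S \<inter> {0..<1} = (\<Union>c\<in>S. visits K c)" by (auto simp: cpar_def visits_def)
  moreover have "card (\<Union>c\<in>S. visits K c) = (\<Sum>c\<in>S. card (visits K c))"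
    using fS assms finite_visits by (intro card_UN_disjoint) (auto simp: visits_def)
  moreover have "\<dots> = (\<Sum>c\<in>S. 2)"
    using assms cls_sub_dbl tw by (intro sum.cong) (auto simp: twisted_diagram_def)
  ultimately show ?thesis by simp
qed

lemma component_eq:
  assumes "visits K c = {u, v}" "u < v"
  shows "component K c 0 = {u<..<v}" "component K c 1 = {v<..<u + 1}"
  using assms by (simp_all add: component_def Let_def min_def max_def)

lemma component_card:
  assumes "c \<in> cls K" "\<And>t. t + 1 \<in> X \<longleftrightarrow> t \<in> X" "finite (X \<inter> {0..<1})"
  shows "finite (X \<inter> component K c 0)" "finite (X \<inter> component K c 1)"
    "card (X \<inter> {0..<1}) =
      card (X \<inter> component K c 0) + card (X \<inter> component K c 1) + card (X \<inter> visits K c)"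
proof -
  obtain u v where uv: "visits K c = {u, v}" "u < v" "0 \<le> u" "v < 1"
    using cls_visits assms(1) by blast
  note s = split_unit[OF assms(2,3) uv(3,2,4)]
  show "finite (X \<inter> component K c 0)"
    unfolding component_eq[OF uv(1,2)] using uv by (auto intro!: finite_subset[OF _ assms(3)])
  show "finite (X \<inter> component K c 1)" unfolding component_eq[OF uv(1,2)] using s(1) .
  show "card (X \<inter> {0..<1}) =
      card (X \<inter> component K c 0) + card (X \<inter> component K c 1) + card (X \<inter> visits K c)"
    unfolding component_eq[OF uv(1,2)] uv(1) using s(2) .
qed

text \<open>The crossing itself takes away 0 or 2 elements of \<open>X\<close>, so the parities on
  the two components differ by the parity over a whole period. That total is even for passages; for
  bars it can be odd and has to be carried along as a separate datum.\<close>

lemma component_even: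
  assumes "c \<in> cls K" "\<And>t. t + 1 \<in> X \<longleftrightarrow> t \<in> X" "finite (X \<inter> {0..<1})"
    and "visits K c \<subseteq> X \<or> visits K c \<inter> X = {}"
  shows "even (card (X \<inter> component K c 1)) \<longleftrightarrow>
    (even (card (X \<inter> {0..<1})) \<longleftrightarrow> even (card (X \<inter> component K c 0)))"
proof -
  obtain u v where uv: "visits K c = {u, v}" "u < v"
    using cls_visits assms(1) by blast
  have "even (card (X \<inter> visits K c))"
    using assms(4)
  proof
    assume "visits K c \<subseteq> X"
    then have "X \<inter> visits K c = {u, v}" using uv by auto
    then show ?thesis using uv by simp
  next
    assume "visits K c \<inter> X = {}"
    then have "X \<inter> visits K c = {}" by auto
    then show ?thesis by simp
  qed
  then show ?thesis using component_card(3)[OF assms(1-3)] by auto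
qed

text \<open>The count below the larger parameter includes the smaller one, whereas the open
  component omits it: this is the origin of the correction \<open>u \<notin> X\<close>.\<close>

lemma component_even_low:
  assumes "visits K c = {u, v}" "u \<noteq> v" "finite (X \<inter> {0..<1})" "u \<in> X \<longleftrightarrow> v \<in> X"
  shows "even (card (X \<inter> component K c 0)) \<longleftrightarrow> (low_odd X u = low_odd X v) = (u \<notin> X)"
proof -
  have main: "even (card (X \<inter> {x<..<y})) \<longleftrightarrow> (low_odd X x = low_odd X y) = (x \<notin> X)"
    if xy: "0 \<le> x" "x < y" "y < 1" for x y
  proof -
    have "X \<inter> {0..<y} = (X \<inter> {0..<x}) \<union> ((X \<inter> {x<..<y}) \<union> (X \<inter> {x}))" using xy by auto
    moreover have "finite (X \<inter> {0..<x})" "finite (X \<inter> {x<..<y})"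
      using xy by (auto intro!: finite_subset[OF _ assms(3)])
    ultimately have
      "card (X \<inter> {0..<y}) = card (X \<inter> {0..<x}) + (card (X \<inter> {x<..<y}) + card (X \<inter> {x}))"
      by (simp only:) (subst card_Un_disjoint; (auto)[])+
    moreover have "card (X \<inter> {x}) = (if x \<in> X then 1 else 0)" by simp
    ultimately show ?thesis unfolding low_odd_def by (auto split: if_splits)
  qed
  have "u \<in> visits K c" "v \<in> visits K c" using assms(1) by auto
  then have uv: "0 \<le> u" "u < 1" "0 \<le> v" "v < 1" by (auto simp: visits_def)
  show ?thesis
  proof (cases "u < v")
    case True
    then show ?thesis using main[of u v] uv assms(1) component_eq(1) by simp
  next
    case False
    then have "v < u" "visits K c = {v, u}" using assms by auto
    then show ?thesis using main[of v u] uv component_eq(1)[of c v u] assms(4) by auto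
  qed
qed

lemma passes_eq: "passes K c l = cpar K (cls K) \<inter> component K c l"
  by (auto simp: passes_def cpar_def)

lemma visits_cpar: "visits K c \<subseteq> cpar K S \<or> visits K c \<inter> cpar K S = {}"
  by (auto simp: visits_def cpar_def)

lemma odd_weight: "odd ((- 1) ^ eps K t * crossing_sign K c)"
  by (simp add: crossing_sign_def eps_def)

lemma ZC_eq: "ZC K = {c \<in> cls K. even (card (cpar K (cls K) \<inter> component K c 0))}"
proof -
  have "even (aff_ind K c l) \<longleftrightarrow> even (card (cpar K (cls K) \<inter> component K c 0))"
    if c: "c \<in> cls K" and l: "l = 0 \<or> l = 1" for c l
  proof -
    note X = cpar_periodic[of _ "cls K"] finite_cpar[OF order_refl]
    have "finite (passes K c l)"
      using component_card(1,2)[OF c X] l by (auto simp: passes_eq)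
    then have "even (aff_ind K c l) \<longleftrightarrow> even (card (passes K c l))"
      unfolding aff_ind_def by (rule even_sum_of_odd) (rule odd_weight)
    also have "\<dots> \<longleftrightarrow> even (card (cpar K (cls K) \<inter> component K c 0))"
      using component_even[OF c X visits_cpar] even_card_cpar[OF order_refl] l
      by (auto simp: passes_eq)
    finally show ?thesis .
  qed
  then show ?thesis unfolding ZC_def by auto
qed

lemma ZC_sub: "ZC K \<subseteq> cls K"
  by (auto simp: ZC_def)

lemma zres_eq:
  assumes "c \<in> cls K"
  shows "zres K c = card (cpar K (ZC K) \<inter> component K c 0) mod 2"
proof -
  have eq: "{t \<in> passes K c 0. crv K t \<in> ZC K} = cpar K (ZC K) \<inter> component K c 0"
    using ZC_sub by (auto simp: passes_def cpar_def)
  have "finite (cpar K (ZC K) \<inter> component K c 0)"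
    by (rule component_card(1)[OF assms cpar_periodic finite_cpar[OF ZC_sub]])
  then have "even (zind K c 0) \<longleftrightarrow> even (card (cpar K (ZC K) \<inter> component K c 0))"
    unfolding zind_def eq by (rule even_sum_of_odd) (rule odd_weight)
  moreover have "nat (i mod 2) = n mod 2" if "even i \<longleftrightarrow> even n" for i :: int and n :: nat
    using that by (cases "even i") (auto simp: even_iff_mod_2_eq_zero not_mod_2_eq_0_eq_1)
  ultimately show ?thesis unfolding zres_def by blast
qed

lemma Qz_eq: "Qz K = (\<Sum>c\<in>cls K. summand K c)"
proof -
  have "(\<Sum>c\<in>cls K. summand K c) = (\<Sum>c\<in>ZC K. summand K c) + (\<Sum>c\<in>cls K - ZC K. summand K c)"
    using sum.subset_diff[OF ZC_sub finite_cls] by (simp add: add.commute)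
  also have "(\<Sum>c\<in>ZC K. summand K c) = (\<Sum>c\<in>ZC K. of_int (crossing_sign K c) *
        (var_s ^ zres K c * var_t ^ bar_parity K c 0 - 1) *
        (var_s ^ zres K c * var_t ^ bar_parity K c 1 - 1))"
    by (rule sum.cong) (simp_all add: summand_def cweight_def wt_def sdeg_def mult.assoc)
  also have "(\<Sum>c\<in>cls K - ZC K. summand K c) =
      (\<Sum>c\<in>cls K - ZC K. of_int (crossing_sign K c) *
        (var_s * var_t ^ bar_parity K c 0 - 1) * (var_s * var_t ^ bar_parity K c 1 - 1))"
    by (rule sum.cong) (simp_all add: summand_def cweight_def wt_def sdeg_def mult.assoc)
  finally show ?thesis unfolding Qz_def by simp
qed

lemma over_under:
  assumes "c \<in> cls K" "visits K c = {u, v}" "u \<noteq> v" "u \<in> ups K"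
  shows "v \<notin> ups K" "crossing_sign K c = (if turn (vel K u) (vel K v) > 0 then 1 else - 1)"
proof -
  have 1: "card (visits K c \<inter> ups K) = 1" using tw assms(1) by (auto simp: twisted_diagram_def)
  show v: "v \<notin> ups K"
  proof
    assume "v \<in> ups K"
    then have "visits K c \<inter> ups K = {u, v}" using assms by auto
    then show False using 1 assms(3) by simp
  qed
  have "over_at K c = u" "under_at K c = v"
    unfolding over_at_def under_at_def using assms v by auto
  then show "crossing_sign K c = (if turn (vel K u) (vel K v) > 0 then 1 else - 1)"
    by (simp add: crossing_sign_def)
qed

lemma some_over:
  assumes "c \<in> cls K" "visits K c = {u, v}"
  shows "u \<in> ups K \<or> v \<in> ups K"
proof -
  have "card (visits K c \<inter> ups K) = 1" using tw assms(1) by (auto simp: twisted_diagram_def)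
  then have "visits K c \<inter> ups K \<noteq> {}" by auto
  then show ?thesis using assms(2) by auto
qed

lemma turn_nonzero:
  assumes "c \<in> cls K" "visits K c = {u, v}" "u \<noteq> v"
  shows "turn (vel K u) (vel K v) \<noteq> 0"
  using tw assms cls_sub_dbl unfolding twisted_diagram_def by blast

text \<open>Frees the sign from the choice of the over strand as first strand: exchanging
  \<open>u\<close> and \<open>v\<close> negates both \<open>u \<in> ups K\<close> and the direction,
  the latter because transversality excludes the value 0.\<close>

lemma crossing_sign_dir:
  assumes "c \<in> cls K" "visits K c = {u, v}" "u \<noteq> v"
  shows "crossing_sign K c = (if u \<in> ups K \<longleftrightarrow> dir K u v > 0 then 1 else - 1)"
proof (cases "u \<in> ups K")
  case True
  then show ?thesis using over_under(2)[OF assms] by simp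
next
  case False
  then have v: "v \<in> ups K" using some_over[OF assms(1,2)] by simp
  have "visits K c = {v, u}" "v \<noteq> u" using assms by auto
  from over_under(2)[OF assms(1) this v] False turn_nonzero[OF assms]
  show ?thesis by (simp add: turn_swap[of "vel K v"])
qed

end

text \<open>The labels \<open>l\<close> and \<open>l'\<close> may be interchanged, as happens when a
  reparametrization carries the base point to the other component; the weight does not notice it,
  being symmetric in the two bar parities. The residues are compared under the assumption
  \<open>c \<in> ZC K\<close> only, since elsewhere the exponent of s is 1.\<close>

lemma cweight_cong:
  assumes "tw_diagram K" "tw_diagram K'"
    and "c \<in> cls K" "c' \<in> cls K'"
    and "c \<in> ZC K \<longleftrightarrow> c' \<in> ZC K'"
    and "c \<in> ZC K \<Longrightarrow> even (card (cpar K (ZC K) \<inter> component K c 0)) \<longleftrightarrow>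
      even (card (cpar K' (ZC K') \<inter> component K' c' 0))"
    and "{l, l'} = {0, 1}"
    and "even (card (bars K \<inter> component K c 0)) \<longleftrightarrow> even (card (bars K' \<inter> component K' c' l))"
    and "even (card (bars K \<inter> component K c 1)) \<longleftrightarrow> even (card (bars K' \<inter> component K' c' l'))"
  shows "cweight K c = cweight K' c'"
proof -
  have mod2: "m mod 2 = n mod 2" if "even m \<longleftrightarrow> even n" for m n :: nat
    using that by presburger
  have "sdeg K c = sdeg K' c'"
  proof (cases "c \<in> ZC K")
    case True
    then have "zres K c = zres K' c'"
      unfolding tw_diagram.zres_eq[OF assms(1,3)] tw_diagram.zres_eq[OF assms(2,4)]
      by (intro mod2 assms(6))
    then show ?thesis using True assms(5) by (simp add: sdeg_def)
  next
    case False
    then show ?thesis using assms(5) by (simp add: sdeg_def)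
  qed
  moreover have "bar_parity K c 0 = bar_parity K' c' l" "bar_parity K c 1 = bar_parity K' c' l'"
    unfolding bar_parity_def by (rule mod2, rule assms)+
  moreover have "l = 0 \<and> l' = 1 \<or> l = 1 \<and> l' = 0" using assms(7) by (auto simp: doubleton_eq_iff)
  ultimately show ?thesis
    using wt_commute[of _ "bar_parity K c 0"] by (elim disjE) (simp_all add: cweight_def)
qed

section \<open>Crossing changes, bars and isotopies\<close>

lemma vel_update [simp]: "vel (K\<lparr>ups := U\<rparr>) = vel K" "vel (K\<lparr>bars := B\<rparr>) = vel K"
  by (simp_all add: vel_def fun_eq_iff)

lemma visits_update [simp]:
  "visits (K\<lparr>ups := U\<rparr>) = visits K" "visits (K\<lparr>bars := B\<rparr>) = visits K"
  by (simp_all add: visits_def fun_eq_iff)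

lemma dbl_update [simp]: "dbl (K\<lparr>ups := U\<rparr>) = dbl K" "dbl (K\<lparr>bars := B\<rparr>) = dbl K"
  by (simp_all add: dbl_def)

lemma component_update [simp]:
  "component (K\<lparr>ups := U\<rparr>) = component K" "component (K\<lparr>bars := B\<rparr>) = component K"
  by (simp_all add: component_def fun_eq_iff)

lemma cpar_update [simp]: "cpar (K\<lparr>ups := U\<rparr>) = cpar K" "cpar (K\<lparr>bars := B\<rparr>) = cpar K"
  by (simp_all add: cpar_def fun_eq_iff)

lemma crossing_sign_bars_update [simp]: "crossing_sign (K\<lparr>bars := B\<rparr>) = crossing_sign K"
  by (simp add: crossing_sign_def over_at_def under_at_def fun_eq_iff)

section \<open>Crossing changes\<close>

lemma crossing_change_twisted:
  assumes "twisted_diagram K" "crossing_change K K'"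
  shows "twisted_diagram K'"
proof -
  interpret tw_diagram K using assms(1) by unfold_locales
  obtain c where c: "c \<in> cls K"
    and K': "K' = K\<lparr>ups := {t. if crv K t = c then t \<notin> ups K else t \<in> ups K}\<rparr>"
    using assms(2) by (auto simp: crossing_change_def)
  have "card (visits K p \<inter> ups K') = 1" if p: "p \<in> cls K" for p
  proof (cases "p = c")
    case True
    obtain u v where uv: "visits K c = {u, v}" "u < v" using cls_visits c by blast
    \<comment> \<open>At \<open>c\<close> the over set is complemented within the two visits, and
      exactly one of the two visits was an over-pass before.\<close>
    have "visits K c \<inter> ups K' = {u, v} - ups K"
      using uv unfolding K' by (auto simp: visits_def)
    moreover have "\<not> (u \<in> ups K \<and> v \<in> ups K)"
      using over_under(1)[OF c uv(1)] uv(2) by auto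
    then have "{u, v} - ups K = {u} \<or> {u, v} - ups K = {v}"
      using some_over[OF c uv(1)] by auto
    then have "card ({u, v} - ups K) = 1" by auto
    ultimately show ?thesis using True by simp
  next
    case False
    then have "visits K p \<inter> ups K' = visits K p \<inter> ups K" unfolding K' by (auto simp: visits_def)
    then show ?thesis using tw p by (simp add: twisted_diagram_def)
  qed
  moreover have "\<forall>t. t + 1 \<in> ups K' \<longleftrightarrow> t \<in> ups K'" "\<forall>t\<in>ups K'. crv K t \<in> cls K"
    using ups_periodic crv_periodic ups_cls c unfolding K' by (auto split: if_splits)
  ultimately show ?thesis
    using tw unfolding twisted_diagram_def by (simp add: K')
qed

text \<open>The witnesses are data of the changed crossing \<open>c\<close>: \<open>a\<close> is its
  sign before the change, \<open>b\<close> its exponent of s, and \<open>p\<close>, \<open>q\<close>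
  are its bar parities, all of which except the sign are the same before and after.\<close>

lemma Qz_crossing_change:
  assumes "twisted_diagram K" "crossing_change K K'"
  shows "\<exists>a b p q. a \<in> {-1, 1} \<and> b \<in> {0, 1} \<and> p \<in> {0, 1} \<and> q \<in> {0, 1} \<and>
    Qz K - Qz K' = 2 * of_int a * wt b p q"
proof -
  interpret tw_diagram K using assms(1) by unfold_locales
  interpret K': tw_diagram K' using crossing_change_twisted[OF assms] by unfold_locales
  obtain c where c: "c \<in> cls K"
    and K': "K' = K\<lparr>ups := {t. if crv K t = c then t \<notin> ups K else t \<in> ups K}\<rparr>"
    using assms(2) by (auto simp: crossing_change_def)
  have cls: "cls K' = cls K" unfolding K' by simp
  have ZC: "ZC K' = ZC K" unfolding ZC_eq K'.ZC_eq unfolding K' by simp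
  have sdeg: "sdeg K' d = sdeg K d" if "d \<in> cls K" for d
    unfolding sdeg_def ZC zres_eq[OF that] K'.zres_eq[OF that[folded cls]] by (simp add: K')
  have bp: "bar_parity K' = bar_parity K" unfolding K' by (simp add: bar_parity_def fun_eq_iff)
  have sign: "crossing_sign K' d = (if d = c then - crossing_sign K d else crossing_sign K d)"
    if d: "d \<in> cls K" for d
  proof -
    obtain u v where uv: "visits K d = {u, v}" "u < v" "crv K u = d" using cls_visits d by blast
    have "visits K' d = {u, v}" using uv(1) by (simp add: K')
    then have "crossing_sign K' d = (if u \<in> ups K' \<longleftrightarrow> dir K u v > 0 then 1 else - 1)"
      using K'.crossing_sign_dir[of d u v] uv(2) d cls by (simp add: K')
    moreover have "u \<in> ups K' \<longleftrightarrow> (if d = c then u \<notin> ups K else u \<in> ups K)"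
      unfolding K' using uv by simp
    ultimately show ?thesis using crossing_sign_dir[OF d uv(1)] uv(2) by auto
  qed
  have "Qz K - Qz K' = (\<Sum>d\<in>cls K. summand K d - summand K' d)"
    unfolding Qz_eq K'.Qz_eq cls by (simp add: sum_subtractf)
  also have "\<dots> = (\<Sum>d\<in>cls K. if d = c then 2 * summand K c else 0)"
    by (rule sum.cong) (auto simp: summand_def cweight_def sdeg bp sign)
  also have "\<dots> = 2 * summand K c" using c finite_cls by simp
  finally have "Qz K - Qz K' = 2 * of_int (crossing_sign K c) *
      wt (sdeg K c) (bar_parity K c 0) (bar_parity K c 1)"
    by (simp add: summand_def cweight_def mult.assoc)
  moreover have "crossing_sign K c \<in> {-1, 1}" by (simp add: crossing_sign_def)
  moreover have "sdeg K c \<in> {0, 1}" by (auto simp: sdeg_def zres_eq[OF c])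
  moreover have "bar_parity K c l \<in> {0, 1}" for l by (auto simp: bar_parity_def)
  ultimately show ?thesis by blast
qed

section \<open>Moves of bars along the curve: T1 and T2\<close>

lemma Qz_change_bars:
  assumes "twisted_diagram K" "twisted_diagram (K\<lparr>bars := B\<rparr>)"
    and "\<And>c l. c \<in> cls K \<Longrightarrow> l \<in> {0, 1} \<Longrightarrow>
      even (card (bars K \<inter> component K c l)) \<longleftrightarrow> even (card (B \<inter> component K c l))"
  shows "Qz K = Qz (K\<lparr>bars := B\<rparr>)"
proof -
  interpret tw_diagram K using assms(1) by unfold_locales
  interpret K': tw_diagram "K\<lparr>bars := B\<rparr>" using assms(2) by unfold_locales
  have ZC: "ZC (K\<lparr>bars := B\<rparr>) = ZC K" unfolding ZC_eq K'.ZC_eq by simp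
  have "summand K c = summand (K\<lparr>bars := B\<rparr>) c" if "c \<in> cls K" for c
    unfolding summand_def crossing_sign_bars_update
    by (rule arg_cong[OF cweight_cong[where l = 0 and l' = 1, OF tw_diagram_axioms K'.tw_diagram_axioms]])
      (use that assms(3) ZC in simp_all)
  then show ?thesis unfolding Qz_eq K'.Qz_eq by simp
qed

lemma component_interval:
  assumes "twisted_diagram K" "c \<in> cls K" "l \<in> {0, 1}"
  obtains x y where "component K c l = {x<..<y}" "crv K x = c" "crv K y = c" "x < y" "y < x + 1"
proof -
  interpret tw_diagram K using assms(1) by unfold_locales
  obtain u v where uv: "visits K c = {u, v}" "u < v" "0 \<le> u" "v < 1" "crv K u = c" "crv K v = c"
    using cls_visits assms(2) by blast
  note e = component_eq[OF uv(1,2)]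
  show thesis
    using assms(3) that[of u v] that[of v "u + 1"] e uv crv_periodic[of u] by auto
qed

text \<open>The ends of a component are visits to \<open>c\<close>, and no visit to a classical
  crossing lies in a translate of \<open>{u..v}\<close>. Hence \<open>u + k\<close> and
  \<open>v + k\<close> lie on the component together or not at all. All translates are considered
  because component 1 may reach beyond 1.\<close>

lemma card_translates_interval:
  assumes "twisted_diagram K" "c \<in> cls K" "l \<in> {0, 1}"
    and "u < v" "\<And>t. t \<in> {u..v} \<Longrightarrow> crv K t \<notin> cls K"
  shows "card (translates u \<inter> component K c l) = card (translates v \<inter> component K c l)"
proof -
  interpret tw_diagram K using assms(1) by unfold_locales
  obtain x y where xy: "component K c l = {x<..<y}" "crv K x = c" "crv K y = c" "x < y" "y < x + 1"
    using component_interval assms(1-3) by blast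
  have iff: "u + of_int k \<in> {x<..<y} \<longleftrightarrow> v + of_int k \<in> {x<..<y}" for k
  proof -
    have out: "\<not> (u + of_int k \<le> w \<and> w \<le> v + of_int k)" if "crv K w = c" for w
    proof
      assume "u + of_int k \<le> w \<and> w \<le> v + of_int k"
      then have "w + of_int (- k) \<in> {u..v}" by auto
      then have "crv K (w + of_int (- k)) \<notin> cls K" by (rule assms(5))
      then show False unfolding crv_shift using that assms(2) by simp
    qed
    show ?thesis using out[OF xy(2)] out[OF xy(3)] assms(4) by auto
  qed
  have "translates v \<inter> {x<..<y} = (\<lambda>t. t + (v - u)) ` (translates u \<inter> {x<..<y})"
  proof (intro equalityI subsetI)
    fix t assume t: "t \<in> translates v \<inter> {x<..<y}"
    then obtain k where k: "t = v + of_int k" by (auto simp: translates_def)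
    then have "u + of_int k \<in> translates u \<inter> {x<..<y}" using iff t by (auto simp: translates_def)
    then show "t \<in> (\<lambda>t. t + (v - u)) ` (translates u \<inter> {x<..<y})"
      using k by (intro image_eqI[of _ _ "u + of_int k"]) auto
  next
    fix t assume "t \<in> (\<lambda>t. t + (v - u)) ` (translates u \<inter> {x<..<y})"
    then obtain k where k: "t = v + of_int k" "u + of_int k \<in> {x<..<y}"
      by (auto simp: translates_def)
    then show "t \<in> translates v \<inter> {x<..<y}" using iff by (auto simp: translates_def)
  qed
  then show ?thesis unfolding xy(1) by (simp add: card_image)
qed

text \<open>No classical crossing separates the two new bars, so each component receives equally
  many translates of either one, an even number in total.\<close>

lemma Qz_move_T1:
  assumes "twisted_diagram K" "twisted_diagram K'" "move_T1 K K'"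
  shows "Qz K = Qz K'"
proof -
  obtain u v where uv: "u < v" "v < u + 1" "\<forall>t\<in>{u..v}. crv K t \<notin> dbl K \<and> t \<notin> bars K"
    and K': "K' = K\<lparr>bars := bars K \<union> translates u \<union> translates v\<rparr>"
    using assms(3) by (auto simp: move_T1_def)
  interpret tw_diagram K using assms(1) by unfold_locales
  interpret K': tw_diagram K' using assms(2) by unfold_locales
  let ?B = "bars K \<union> translates u \<union> translates v"
  \<comment> \<open>A common translate would make \<open>v - u\<close> an integer strictly between 0
    and 1.\<close>
  have disj: "translates u \<inter> translates v = {}"
  proof (rule ccontr)
    assume "translates u \<inter> translates v \<noteq> {}"
    then obtain j k :: int where "u + of_int j = v + of_int k" by (auto simp: translates_def)
    then have "v - u = of_int (j - k)" by simp
    then have "0 < real_of_int (j - k)" "real_of_int (j - k) < 1" using uv by linarith+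
    then have "0 < j - k" "j - k < 1" by (simp_all only: of_int_0_less_iff of_int_less_1_iff)
    then show False by simp
  qed
  have nb: "bars K \<inter> translates w = {}" if "w \<in> {u..v}" for w
    using uv(3) that periodic_int[of "bars K", OF bars_periodic] by (auto simp: translates_def)
  have "even (card (bars K \<inter> component K c l)) \<longleftrightarrow> even (card (?B \<inter> component K c l))"
    if c: "c \<in> cls K" and l: "l \<in> {0, 1}" for c l
  proof -
    let ?C = "component K c l"
    have "?C = component K' c l" "c \<in> cls K'" using c by (simp_all add: K')
    then have "finite (bars K' \<inter> ?C)"
      using K'.component_card(1,2)[OF _ K'.bars_periodic K'.finite_bars] l by auto
    then have "finite (?B \<inter> ?C)" by (simp add: K')
    then have fin: "finite (bars K \<inter> ?C)" "finite (translates u \<inter> ?C)" "finite (translates v \<inter> ?C)"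
      by (rule rev_finite_subset, blast)+
    have eq: "?B \<inter> ?C = (bars K \<inter> ?C) \<union> ((translates u \<inter> ?C) \<union> (translates v \<inter> ?C))" by auto
    have "bars K \<inter> translates u = {}" "bars K \<inter> translates v = {}"
      by (rule nb; use uv(1) in simp)+
    then have "(bars K \<inter> ?C) \<inter> ((translates u \<inter> ?C) \<union> (translates v \<inter> ?C)) = {}"
      and "(translates u \<inter> ?C) \<inter> (translates v \<inter> ?C) = {}" using disj by blast+
    then have "card (?B \<inter> ?C) = card (bars K \<inter> ?C) +
        (card (translates u \<inter> ?C) + card (translates v \<inter> ?C))"
      unfolding eq using fin by (simp only: card_Un_disjoint finite_Un)
    moreover have "card (translates u \<inter> ?C) = card (translates v \<inter> ?C)"
      using card_translates_interval[OF assms(1) c l uv(1)] uv(3) cls_sub_dbl by blast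
    ultimately show ?thesis by simp
  qed
  then show ?thesis using Qz_change_bars[of K ?B] assms unfolding K' by blast
qed

text \<open>The only double point passed by the bar is virtual, so the segment \<open>{u..v}\<close>
  avoids the classical crossings, and the old and the new position lie on the same component of
  every smoothing.\<close>

lemma Qz_move_T2:
  assumes "twisted_diagram K" "twisted_diagram K'" "move_T2 K K'"
  shows "Qz K = Qz K'"
proof -
  obtain u w v where uv: "u < w" "w < v" "v < u + 1" "crv K w \<in> dbl K - cls K"
      "\<forall>t\<in>{u..v}. t \<noteq> w \<longrightarrow> crv K t \<notin> dbl K" "bars K \<inter> {u..v} = {u}"
    and K': "K' = K\<lparr>bars := (bars K - translates u) \<union> translates v\<rparr>"
    using assms(3) by (auto simp: move_T2_def)
  interpret tw_diagram K using assms(1) by unfold_locales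
  interpret K': tw_diagram K' using assms(2) by unfold_locales
  let ?B = "(bars K - translates u) \<union> translates v"
  have "u \<in> bars K" using uv(6) by blast
  have "v \<notin> bars K"
  proof
    assume "v \<in> bars K"
    then have "v \<in> {u}" using uv(1,2) unfolding uv(6)[symmetric] by simp
    then show False using uv(1,2) by simp
  qed
  have sub: "translates u \<subseteq> bars K" and nb: "bars K \<inter> translates v = {}"
    using \<open>u \<in> bars K\<close> \<open>v \<notin> bars K\<close> periodic_int[of "bars K", OF bars_periodic]
    by (auto simp: translates_def)
  have "even (card (bars K \<inter> component K c l)) \<longleftrightarrow> even (card (?B \<inter> component K c l))"
    if c: "c \<in> cls K" and l: "l \<in> {0, 1}" for c l
  proof -
    let ?C = "component K c l"
    have "?C = component K' c l" "c \<in> cls K'" using c by (simp_all add: K')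
    then have "finite (bars K' \<inter> ?C)" and fin: "finite (bars K \<inter> ?C)"
      using K'.component_card(1,2)[OF _ K'.bars_periodic K'.finite_bars]
        component_card(1,2)[OF c bars_periodic finite_bars] l by auto
    then have "finite (?B \<inter> ?C)" by (simp add: K')
    then have finv: "finite (translates v \<inter> ?C)" by (rule rev_finite_subset) blast
    have finu: "finite (translates u \<inter> ?C)" using fin by (rule rev_finite_subset) (use sub in blast)
    have "card ((bars K \<inter> ?C) - (translates u \<inter> ?C)) = card (bars K \<inter> ?C) - card (translates u \<inter> ?C)"
      using finu sub by (intro card_Diff_subset) auto
    moreover have "card (translates u \<inter> ?C) \<le> card (bars K \<inter> ?C)"
      using fin sub by (intro card_mono) auto
    moreover have "?B \<inter> ?C = ((bars K \<inter> ?C) - (translates u \<inter> ?C)) \<union> (translates v \<inter> ?C)" by auto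
    then have "card (?B \<inter> ?C) = card ((bars K \<inter> ?C) - (translates u \<inter> ?C)) + card (translates v \<inter> ?C)"
      using fin finv nb by (simp only:) (subst card_Un_disjoint; (simp; fail | blast)?)
    moreover have "crv K t \<notin> cls K" if "t \<in> {u..v}" for t
      using uv(4,5) cls_sub_dbl that by (cases "t = w") auto
    then have "card (translates u \<inter> ?C) = card (translates v \<inter> ?C)"
      using card_translates_interval[OF assms(1) c l] uv(1,2) by simp
    ultimately show ?thesis by simp
  qed
  then show ?thesis using Qz_change_bars[of K ?B] assms unfolding K' by blast
qed

section \<open>Orientation and planar isotopy; \<open>turn (L 1) (L \<i>)\<close> is the determinant
  of \<open>L\<close>\<close>

lemma turn_linear:
  assumes "linear L"
  shows "turn (L v) (L w) = turn (L 1) (L \<i>) * turn v w"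
proof -
  have "L z = Re z *\<^sub>R L 1 + Im z *\<^sub>R L \<i>" for z
  proof -
    have "L (Re z *\<^sub>R 1 + Im z *\<^sub>R \<i>) = Re z *\<^sub>R L 1 + Im z *\<^sub>R L \<i>"
      using assms by (simp only: linear_add linear_scale)
    moreover have "Re z *\<^sub>R 1 + Im z *\<^sub>R \<i> = z" by (simp add: complex_eq_iff)
    ultimately show ?thesis by (simp only:)
  qed
  from this[of v] this[of w] show ?thesis by (simp add: turn_def algebra_simps)
qed

lemma turn_linear_nonzero:
  assumes "linear L" "inj L"
  shows "turn (L 1) (L \<i>) \<noteq> 0"
proof
  assume z: "turn (L 1) (L \<i>) = 0"
  have scale: "L (x *\<^sub>R v + y *\<^sub>R w) = x *\<^sub>R L v + y *\<^sub>R L w" for x y v w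
    using assms(1) by (simp only: linear_add linear_scale)
  have inj: "L v = 0 \<Longrightarrow> v = 0" for v
    using assms linear_0 injD by metis
  define p where "p = L 1"
  define q where "q = L \<i>"
  have z: "Re p * Im q = Im p * Re q" using z by (simp add: turn_def p_def q_def)
  \<comment> \<open>If the columns \<open>p\<close> and \<open>q\<close> of the matrix of
    \<open>L\<close> are dependent, then each row, rotated by a right angle, is a kernel vector.
    Injectivity makes all four entries vanish.\<close>
  have "L (Re q *\<^sub>R 1 + (- Re p) *\<^sub>R \<i>) = 0" "L (Im q *\<^sub>R 1 + (- Im p) *\<^sub>R \<i>) = 0"
    unfolding scale p_def[symmetric] q_def[symmetric] using z
    by (simp_all add: complex_eq_iff mult.commute)
  from this[THEN inj] have "p = 0" by (simp add: complex_eq_iff)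
  then have "(1::complex) = 0" unfolding p_def by (rule inj)
  then show False by simp
qed

text \<open>Along the isotopy the determinant of the derivative at \<open>x\<close> is continuous in
  \<open>s\<close>, equals 1 at the start and never vanishes, so it stays positive by the
  intermediate value theorem. A final map that reversed the orientation would negate all crossing
  signs.\<close>

lemma ambient_isotopy_orientation:
  assumes "ambient_isotopy H H'" "s \<in> {0..1}"
  shows "turn (H' s x 1) (H' s x \<i>) > 0"
proof -
  define d where "d s = turn (blinfun_apply (H' s x) 1) (blinfun_apply (H' s x) \<i>)" for s
  have c: "continuous_on ({0..1} \<times> UNIV) (\<lambda>(s, x). H' s x)" and id: "H 0 = id"
    and der: "\<And>s x. s \<in> {0..1} \<Longrightarrow> (H s has_derivative blinfun_apply (H' s x)) (at x)"
    and bij: "\<And>s x. s \<in> {0..1} \<Longrightarrow> bij (blinfun_apply (H' s x))"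
    using assms(1) by (auto simp: ambient_isotopy_def)
  have "continuous_on {0..1} (\<lambda>s. (\<lambda>(s, x). H' s x) (s, x))"
    by (rule continuous_on_compose2[OF c]) (auto intro!: continuous_intros)
  then have "continuous_on {0..1} (\<lambda>s. H' s x)" by simp
  then have dc: "continuous_on {0..1} d"
    unfolding d_def turn_def by (intro continuous_intros)
  have nz: "d s \<noteq> 0" if "s \<in> {0..1}" for s
    unfolding d_def using bij[OF that, of x] der[OF that, of x]
    by (intro turn_linear_nonzero) (auto simp: bij_is_inj has_derivative_linear)
  have "blinfun_apply (H' 0 x) = id"
    using der[of 0 x] has_derivative_id unfolding id by (auto intro: has_derivative_unique)
  then have d0: "d 0 = 1" by (simp add: d_def turn_def)
  have "d s > 0"
  proof (rule ccontr)
    assume "\<not> d s > 0"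
    then have "\<exists>t\<ge>0. t \<le> s \<and> d t = 0"
      using assms(2) d0 by (intro IVT2') (auto intro: continuous_on_subset[OF dc])
    then show False using nz assms(2) by auto
  qed
  then show ?thesis by (simp add: d_def)
qed

context tw_diagram
begin

lemma vel_shift: "vel K (t + of_int k) = vel K t"
proof -
  have "((\<lambda>s. s + of_int k) has_vector_derivative 1) (at t)"
    by (auto intro!: derivative_eq_intros)
  from vector_diff_chain_at[OF this differentiable]
  have "((\<lambda>s. crv K (s + of_int k)) has_vector_derivative vel K (t + of_int k)) (at t)"
    by (simp add: o_def)
  then have "(crv K has_vector_derivative vel K (t + of_int k)) (at t)" by (simp add: crv_shift)
  then show ?thesis using differentiable vector_derivative_unique_at by blast
qed

text \<open>Relates arbitrary lifts \<open>x < y < x + 1\<close> of the two visits to the visits in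
  \<open>{0..<1}\<close> that fix the labels. The translation by \<open>k\<close> brings
  \<open>x\<close> into \<open>{0..<1}\<close>; where \<open>y\<close> then falls decides which of
  the two arcs has label 0.\<close>

lemma arc_components:
  assumes "c \<in> cls K" "crv K x = c" "crv K y = c" "x < y" "y < x + 1"
  obtains l l' j k i where "{l, l'} = {0, 1}"
    "component K c l = (\<lambda>t. t + of_int k) ` {x<..<y}"
    "component K c l' = (\<lambda>t. t + of_int j) ` {y<..<x + 1}"
    "visits K c = {x + of_int k, y + of_int i}" "x + of_int k \<noteq> y + of_int i"
proof -
  define k where "k = - \<lfloor>x\<rfloor>"
  have x: "0 \<le> x + of_int k" "x + of_int k < 1" unfolding k_def by linarith+
  have shift: "(\<lambda>t. t + of_int n) ` {p<..<q} = {p + of_int n<..<q + of_int n}" for n and p q :: real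
  proof (intro equalityI subsetI)
    fix t assume "t \<in> {p + of_int n<..<q + of_int n}"
    then show "t \<in> (\<lambda>t. t + of_int n) ` {p<..<q}"
      by (intro image_eqI[of _ _ "t - of_int n"]) auto
  qed auto
  show thesis
  proof (cases "y + of_int k < 1")
    case True
    have v: "visits K c = {x + of_int k, y + of_int k}"
      using visits_of_pair(2)[of "x + of_int k" "y + of_int k"] x True assms by (simp add: crv_shift)
    have e: "component K c 0 = {x + of_int k<..<y + of_int k}"
      "component K c 1 = {y + of_int k<..<x + of_int k + 1}"
      using component_eq[OF v] assms(4) by simp_all
    show ?thesis
      by (rule that[of 0 1 k k k]) (use v e assms(4) in \<open>simp_all add: shift add.commute add.left_commute\<close>)
  next
    case False
    \<comment> \<open>The second lift has passed 1. It has to be moved back by one period more and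
      becomes the smaller visit, so the labels are exchanged.\<close>
    have v: "visits K c = {y + of_int (k - 1), x + of_int k}"
      using visits_of_pair(2)[of "y + of_int (k - 1)" "x + of_int k"] x False assms
        crv_shift[of y "k - 1"] crv_shift[of x k] by simp
    have lt: "y + of_int (k - 1) < x + of_int k" using assms(5) by simp
    have e: "component K c 0 = {y + of_int (k - 1)<..<x + of_int k}"
      "component K c 1 = {x + of_int k<..<y + of_int (k - 1) + 1}"
      using component_eq[OF v lt] by simp_all
    have c1: "component K c 1 = (\<lambda>t. t + of_int k) ` {x<..<y}"
      and c0: "component K c 0 = (\<lambda>t. t + of_int (k - 1)) ` {y<..<x + 1}"
      unfolding e shift by simp_all
    have v': "visits K c = {x + of_int k, y + of_int (k - 1)}" using v by (simp add: insert_commute)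
    show ?thesis
      by (rule that[OF _ c1 c0 v']) (use lt in auto)
  qed
qed

end

text \<open>The plane map preserves signs because it preserves the orientation, and the
  reparametrization maps the components of each smoothing to components up to periods, possibly with
  exchanged labels.\<close>

lemma Qz_isotopic:
  assumes "twisted_diagram K" "twisted_diagram K'" "isotopic K K'"
  shows "Qz K = Qz K'"
proof -
  interpret tw_diagram K using assms(1) by unfold_locales
  interpret K': tw_diagram K' using assms(2) by unfold_locales
  obtain H H' \<rho> where iso: "ambient_isotopy H H'" and rep: "reparametrization \<rho>"
    and K': "K' = \<lparr>crv = H 1 \<circ> crv K \<circ> \<rho>, cls = H 1 ` cls K, ups = \<rho> -` ups K, bars = \<rho> -` bars K\<rparr>"
    using assms(3) by (auto simp: isotopic_def)
  define h where "h = H 1"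
  have bij: "bij h" and der: "\<And>x. (h has_derivative blinfun_apply (H' 1 x)) (at x)"
    using iso by (auto simp: ambient_isotopy_def h_def)
  note inj = bij_is_inj[OF bij]
  have \<rho>1: "\<rho> (t + 1) = \<rho> t + 1" for t using rep by (simp add: reparametrization_def)
  have \<rho>d: "(\<rho> has_vector_derivative vector_derivative \<rho> (at t)) (at t)" for t
    using rep vector_derivative_works unfolding reparametrization_def C1_differentiable_on_eq by blast
  have \<rho>pos: "vector_derivative \<rho> (at t) > 0" for t using rep by (simp add: reparametrization_def)
  have mono: "\<rho> x < \<rho> y" if "x < y" for x y
    by (rule DERIV_pos_imp_increasing[OF that])
      (use \<rho>d \<rho>pos in \<open>unfold has_real_derivative_iff_has_vector_derivative, blast\<close>)
  then have strict: "strict_mono \<rho>" by (rule strict_monoI)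
  then have iff: "\<rho> x < \<rho> y \<longleftrightarrow> x < y" and inj\<rho>: "inj \<rho>" for x y
    by (simp_all add: strict_mono_less strict_mono_imp_inj_on)
  have cont: "continuous_on S \<rho>" for S
    using \<rho>d has_vector_derivative_continuous by (intro continuous_at_imp_continuous_on) blast
  have img: "\<rho> ` {x<..<y} = {\<rho> x<..<\<rho> y}" for x y
  proof (intro equalityI subsetI)
    fix t assume t: "t \<in> {\<rho> x<..<\<rho> y}"
    then have "x < y" using iff by (metis greaterThanLessThan_iff order.strict_trans)
    then obtain s where s: "x \<le> s" "s \<le> y" "\<rho> s = t"
      using IVT'[of \<rho> x t y] t cont by auto
    then have "s \<in> {x<..<y}" using t by (auto simp: less_le)
    then show "t \<in> \<rho> ` {x<..<y}" using s by blast
  qed (auto simp: mono)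
  have crv: "crv K' t = h (crv K (\<rho> t))" for t by (simp add: K' h_def)
  have cls: "cls K' = h ` cls K" by (simp add: K' h_def)
  have vel: "vel K' t = H' 1 (crv K (\<rho> t)) (vector_derivative \<rho> (at t) *\<^sub>R vel K (\<rho> t))" for t
  proof -
    have "((crv K \<circ> \<rho>) has_derivative (\<lambda>x. x *\<^sub>R (vector_derivative \<rho> (at t) *\<^sub>R vel K (\<rho> t)))) (at t)"
      using vector_diff_chain_at[OF \<rho>d[of t] differentiable[of "\<rho> t"]]
      by (simp add: has_vector_derivative_def)
    from diff_chain_at[OF this der]
    have "((h \<circ> (crv K \<circ> \<rho>)) has_derivative (\<lambda>x. H' 1 (crv K (\<rho> t)) (x *\<^sub>R (vector_derivative \<rho> (at t) *\<^sub>R vel K (\<rho> t))))) (at t)"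
      by (simp add: o_def)
    then have "(crv K' has_vector_derivative H' 1 (crv K (\<rho> t)) (vector_derivative \<rho> (at t) *\<^sub>R vel K (\<rho> t))) (at t)"
      unfolding has_vector_derivative_def K' h_def o_def
      by (simp add: blinfun.scaleR_right)
    then show ?thesis using K'.differentiable vector_derivative_unique_at by blast
  qed
  \<comment> \<open>The counts are stated for every periodic set \<open>X\<close> at once: they are
    needed for the bars and for the passages through \<open>cls K\<close> and \<open>ZC K\<close>,
    always with the same \<open>l\<close> and \<open>l'\<close>.\<close>
  have main: "crossing_sign K' (h c) = crossing_sign K c \<and>
      (\<exists>l l'. {l, l'} = {0, 1} \<and>
        (\<forall>X. (\<forall>t. t + 1 \<in> X \<longleftrightarrow> t \<in> X) \<longrightarrow>
          card (\<rho> -` X \<inter> component K' (h c) 0) = card (X \<inter> component K c l) \<and>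
          card (\<rho> -` X \<inter> component K' (h c) 1) = card (X \<inter> component K c l')))"
    if c: "c \<in> cls K" for c
  proof -
    have c': "h c \<in> cls K'" using c cls by auto
    obtain u v where uv: "visits K' (h c) = {u, v}" "u < v" "0 \<le> u" "v < 1"
        "crv K' u = h c" "crv K' v = h c"
      using K'.cls_visits c' by blast
    have cu: "crv K (\<rho> u) = c" and cv: "crv K (\<rho> v) = c"
      using uv(5,6) inj unfolding crv by (simp_all add: inj_eq)
    have lt: "\<rho> u < \<rho> v" "\<rho> v < \<rho> u + 1"
      using uv mono[of v "u + 1"] by (auto simp: mono \<rho>1)
    obtain l l' j k i where comp: "{l, l'} = {0, 1}"
      "component K c l = (\<lambda>t. t + of_int k) ` {\<rho> u<..<\<rho> v}"
      "component K c l' = (\<lambda>t. t + of_int j) ` {\<rho> v<..<\<rho> u + 1}"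
      "visits K c = {\<rho> u + of_int k, \<rho> v + of_int i}" "\<rho> u + of_int k \<noteq> \<rho> v + of_int i"
      by (rule arc_components[OF c cu cv lt])
    have cards: "card (\<rho> -` X \<inter> {x<..<y}) = card (X \<inter> (\<lambda>t. t + of_int m) ` {\<rho> x<..<\<rho> y})"
      if per: "\<forall>t. t + 1 \<in> X \<longleftrightarrow> t \<in> X" for X x y and m :: int
    proof -
      have mem: "\<rho> t + of_int m \<in> X \<longleftrightarrow> t \<in> \<rho> -` X" for t
        using periodic_int[of X "\<rho> t" m] per by simp
      have "X \<inter> (\<lambda>t. t + of_int m) ` {\<rho> x<..<\<rho> y} = X \<inter> (\<lambda>t. \<rho> t + of_int m) ` {x<..<y}"
        unfolding img[symmetric] image_image ..
      also have "\<dots> = (\<lambda>t. \<rho> t + of_int m) ` (\<rho> -` X \<inter> {x<..<y})"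
        using mem by blast
      finally have "X \<inter> (\<lambda>t. t + of_int m) ` {\<rho> x<..<\<rho> y} =
          (\<lambda>t. \<rho> t + of_int m) ` (\<rho> -` X \<inter> {x<..<y})" .
      moreover have "inj_on (\<lambda>t. \<rho> t + of_int m) (\<rho> -` X \<inter> {x<..<y})"
        by (rule inj_onI) (simp add: inj_eq[OF inj\<rho>])
      ultimately show ?thesis by (simp add: card_image)
    qed
    have "card (\<rho> -` X \<inter> component K' (h c) 0) = card (X \<inter> component K c l) \<and>
          card (\<rho> -` X \<inter> component K' (h c) 1) = card (X \<inter> component K c l')"
      if "\<forall>t. t + 1 \<in> X \<longleftrightarrow> t \<in> X" for X
      unfolding comp(2,3) K'.component_eq[OF uv(1,2)] \<rho>1[symmetric]
      by (intro conjI cards that)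
    moreover have "crossing_sign K' (h c) = crossing_sign K c"
    proof -
      \<comment> \<open>Both velocities are images under the same linear map, the derivative of
        \<open>h\<close> at \<open>c\<close>, multiplied by the positive speeds of
        \<open>\<rho>\<close>; so \<open>turn\<close> is multiplied by a positive number.\<close>
      have "turn (vel K' u) (vel K' v) = vector_derivative \<rho> (at u) * vector_derivative \<rho> (at v) *
          (turn (H' 1 c 1) (H' 1 c \<i>) * turn (vel K (\<rho> u)) (vel K (\<rho> v)))"
        unfolding vel cu cv
        by (subst turn_linear[OF bounded_linear.linear[OF blinfun.bounded_linear_right]])
          (simp add: turn_def algebra_simps)
      then have "dir K' u v = dir K (\<rho> u) (\<rho> v)"
        using \<rho>pos ambient_isotopy_orientation[OF iso, of 1 c] by (simp add: sgn_mult)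
      moreover have "dir K (\<rho> u + of_int k) (\<rho> v + of_int i) = dir K (\<rho> u) (\<rho> v)"
        by (simp add: vel_shift)
      moreover have "u \<in> ups K' \<longleftrightarrow> \<rho> u + of_int k \<in> ups K"
        using periodic_int[of "ups K", OF ups_periodic] by (simp add: K')
      ultimately show ?thesis
        using crossing_sign_dir[OF c comp(4,5)] K'.crossing_sign_dir[OF c' uv(1)] uv(2) by simp
    qed
    ultimately show ?thesis using comp(1) by blast
  qed
  have pc: "cpar K' (h ` S) = \<rho> -` cpar K S" for S
    using inj unfolding cpar_def by (auto simp: crv inj_image_mem_iff)
  have ev: "even (card (cpar K' (h ` S) \<inter> component K' (h c) 0)) \<longleftrightarrow>
      even (card (cpar K S \<inter> component K c 0))" if c: "c \<in> cls K" and S: "S \<subseteq> cls K" for c S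
  proof -
    note X = cpar_periodic[of _ S] finite_cpar[OF S]
    from main[OF c] obtain l l' :: nat where ll: "{l, l'} = {0, 1}" and q: "\<forall>X. (\<forall>t. t + 1 \<in> X \<longleftrightarrow> t \<in> X) \<longrightarrow>
        card (\<rho> -` X \<inter> component K' (h c) 0) = card (X \<inter> component K c l) \<and>
        card (\<rho> -` X \<inter> component K' (h c) 1) = card (X \<inter> component K c l')"
      by (elim conjE exE)
    have "l \<in> {0, 1}" using ll by blast
    moreover have "card (\<rho> -` cpar K S \<inter> component K' (h c) 0) = card (cpar K S \<inter> component K c l)"
      using q[rule_format, of "cpar K S", OF X(1)] by simp
    \<comment> \<open>It does not matter which label \<open>l\<close> is: the total number of
      passages is even, so both components have the same parity.\<close>
    moreover have "even (card (cpar K S \<inter> component K c 1)) \<longleftrightarrow> even (card (cpar K S \<inter> component K c 0))"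
      using component_even[OF c X visits_cpar] even_card_cpar[OF S] by simp
    ultimately show ?thesis by (auto simp: pc)
  qed
  have ZC: "h c \<in> ZC K' \<longleftrightarrow> c \<in> ZC K" if "c \<in> cls K" for c
    using ev[OF that order_refl] that unfolding ZC_eq K'.ZC_eq cls by blast
  have ZC': "ZC K' = h ` ZC K"
    using ZC K'.ZC_sub ZC_sub unfolding cls by blast
  have "summand K c = summand K' (h c)" if c: "c \<in> cls K" for c
  proof -
    have m: "crossing_sign K' (h c) = crossing_sign K c" using main[OF c] by blast
    have B: "bars K' = \<rho> -` bars K" by (simp add: K')
    from main[OF c] obtain l l' :: nat where ll: "{l, l'} = {0, 1}" and q: "\<forall>X. (\<forall>t. t + 1 \<in> X \<longleftrightarrow> t \<in> X) \<longrightarrow>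
        card (\<rho> -` X \<inter> component K' (h c) 0) = card (X \<inter> component K c l) \<and>
        card (\<rho> -` X \<inter> component K' (h c) 1) = card (X \<inter> component K c l')"
      by (elim conjE exE)
    note cards = q[rule_format, of "bars K", OF bars_periodic, folded B]
    have "h c \<in> cls K'" using c cls by blast
    note cong = cweight_cong[OF K'.tw_diagram_axioms tw_diagram_axioms this c ZC[OF c]
        ev[OF c ZC_sub, folded ZC'] ll]
    have "cweight K' (h c) = cweight K c" by (rule cong) (simp_all only: cards)
    then show ?thesis by (simp add: summand_def m)
  qed
  then show ?thesis
    unfolding Qz_eq K'.Qz_eq cls using inj by (simp add: sum.reindex inj_on_subset[OF inj])
qed

section \<open>Local moves\<close>

text \<open>Both visits of \<open>c\<close> belong to the counted set, so the correction for the
  smaller visit is present and an even count means different values of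
  \<open>low_odd\<close>.\<close>

lemma ZC_low:
  assumes "tw_diagram K" "c \<in> cls K" "visits K c = {u, v}" "u \<noteq> v"
  shows "c \<in> ZC K \<longleftrightarrow> low_odd (cpar K (cls K)) u \<noteq> low_odd (cpar K (cls K)) v"
proof -
  interpret tw_diagram K by fact
  have "u \<in> visits K c" "v \<in> visits K c" using assms(3) by auto
  then have "u \<in> cpar K (cls K)" "v \<in> cpar K (cls K)"
    using assms(2) by (auto simp: visits_def cpar_def)
  then show ?thesis
    using component_even_low[OF assms(3,4) finite_cpar[OF order_refl]] assms(2)
    unfolding ZC_eq by blast
qed

text \<open>Only the agreement between the two strands of a crossing is compared, not the single
  values: T3 changes the bar count below both strands, and C2 compares two different crossings of
  one diagram. The premise \<open>B1\<close> compares the total numbers of bars, which determine the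
  parity on component 1 from that on component 0.\<close>

lemma cweight_cong_low:
  assumes "tw_diagram K" "tw_diagram K'" "c \<in> cls K" "c' \<in> cls K'"
    and "visits K c = {u, v}" "u \<noteq> v" "visits K' c' = {u', v'}" "u' \<noteq> v'"
    and P: "(low_odd (cpar K (cls K)) u = low_odd (cpar K (cls K)) v) =
      (low_odd (cpar K' (cls K')) u' = low_odd (cpar K' (cls K')) v')"
    and Z: "c \<in> ZC K \<Longrightarrow> (low_odd (cpar K (ZC K)) u = low_odd (cpar K (ZC K)) v) =
      (low_odd (cpar K' (ZC K')) u' = low_odd (cpar K' (ZC K')) v')"
    and B: "(low_odd (bars K) u = low_odd (bars K) v) = (low_odd (bars K') u' = low_odd (bars K') v')"
    and B1: "low_odd (bars K) 1 = low_odd (bars K') 1"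
  shows "c \<in> ZC K \<longleftrightarrow> c' \<in> ZC K'" "cweight K c = cweight K' c'"
proof -
  interpret K: tw_diagram K by fact
  interpret K': tw_diagram K' by fact
  show ZC: "c \<in> ZC K \<longleftrightarrow> c' \<in> ZC K'"
    using ZC_low[OF assms(1,3,5,6)] ZC_low[OF assms(2,4,7,8)] P by blast
  have m: "crv K u = c" "crv K v = c" "crv K' u' = c'" "crv K' v' = c'"
    using assms(5,7) by (auto simp: visits_def set_eq_iff)
  have nb: "u \<notin> bars K" "v \<notin> bars K" "u' \<notin> bars K'" "v' \<notin> bars K'"
    using m assms(3,4) K.cls_sub_dbl K'.cls_sub_dbl K.bars_not_dbl[of u] K.bars_not_dbl[of v]
      K'.bars_not_dbl[of u'] K'.bars_not_dbl[of v'] by auto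
  have b0: "even (card (bars K \<inter> component K c 0)) \<longleftrightarrow> even (card (bars K' \<inter> component K' c' 0))"
    using K.component_even_low[OF assms(5,6) K.finite_bars]
      K'.component_even_low[OF assms(7,8) K'.finite_bars] nb B by blast
  have dis: "visits K c \<inter> bars K = {}" "visits K' c' \<inter> bars K' = {}"
    using nb assms(5,7) by auto
  have b1: "even (card (bars K \<inter> component K c 1)) \<longleftrightarrow> even (card (bars K' \<inter> component K' c' 1))"
    using K.component_even[OF assms(3) K.bars_periodic K.finite_bars disjI2[OF dis(1)]]
      K'.component_even[OF assms(4) K'.bars_periodic K'.finite_bars disjI2[OF dis(2)]] b0 B1
    unfolding low_odd_def by blast
  have z: "even (card (cpar K (ZC K) \<inter> component K c 0)) \<longleftrightarrow>
      even (card (cpar K' (ZC K') \<inter> component K' c' 0))" if c: "c \<in> ZC K"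
  proof -
    have "u \<in> cpar K (ZC K)" "v \<in> cpar K (ZC K)" "u' \<in> cpar K' (ZC K')" "v' \<in> cpar K' (ZC K')"
      using c ZC m by (auto simp: cpar_def)
    then show ?thesis
      using K.component_even_low[OF assms(5,6) K.finite_cpar[OF K.ZC_sub]]
        K'.component_even_low[OF assms(7,8) K'.finite_cpar[OF K'.ZC_sub]] Z[OF c] by blast
  qed
  show "cweight K c = cweight K' c'"
    by (rule cweight_cong[OF assms(1-4) ZC z refl b0 b1])
qed

section \<open>Two diagrams that agree outside finitely many arcs in a disk\<close>

locale local_pair = K: tw_diagram K + K': tw_diagram K' for K K' +
  fixes n :: nat and a b :: "nat \<Rightarrow> real" and z :: complex and r :: real
  assumes arc_bounds: "i < n \<Longrightarrow> 0 < a i \<and> a i < b i \<and> b i < 1"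
    and arcs_disjoint: "i < n \<Longrightarrow> j < n \<Longrightarrow> i \<noteq> j \<Longrightarrow> {a i..b i} \<inter> {a j..b j} = {}"
    and disk: "meets_disk z r n a b K" and disk': "meets_disk z r n a b K'"
    and same: "t \<in> {0..1} \<Longrightarrow> (\<forall>i<n. t \<notin> {a i<..<b i}) \<Longrightarrow>
        crv K t = crv K' t \<and> (crv K t \<in> cls K \<longleftrightarrow> crv K' t \<in> cls K') \<and>
        (t \<in> ups K \<longleftrightarrow> t \<in> ups K') \<and> (t \<in> bars K \<longleftrightarrow> t \<in> bars K')"
begin

abbreviation arc :: "nat \<Rightarrow> real set" where "arc i \<equiv> {a i<..<b i}"

definition outside :: "real \<Rightarrow> bool" where
  "outside t \<longleftrightarrow> t \<in> {0..1} \<and> (\<forall>i<n. t \<notin> arc i)"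

text \<open>Points outside the arcs include their end points, which may carry bars.\<close>

definition agree :: "real set \<Rightarrow> real set \<Rightarrow> bool" where
  "agree X X' \<longleftrightarrow> finite (X \<inter> {0..<1}) \<and> finite (X' \<inter> {0..<1}) \<and>
    (\<forall>t. outside t \<longrightarrow> (t \<in> X \<longleftrightarrow> t \<in> X')) \<and>
    (\<forall>i<n. even (card (X \<inter> arc i)) \<longleftrightarrow> even (card (X' \<inter> arc i)))"

text \<open>The situation is symmetric in the two diagrams, so every fact about \<open>K\<close> in
  this locale becomes available for \<open>K'\<close> by a second interpretation.\<close>

lemma flip: "local_pair K' K n a b z r"
proof unfold_locales
  show "crv K' t = crv K t \<and> (crv K' t \<in> cls K' \<longleftrightarrow> crv K t \<in> cls K) \<and>
      (t \<in> ups K' \<longleftrightarrow> t \<in> ups K) \<and> (t \<in> bars K' \<longleftrightarrow> t \<in> bars K)"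
    if "t \<in> {0..1}" "\<forall>i<n. t \<notin> arc i" for t
    using same[OF that] by metis
qed (fact arc_bounds arcs_disjoint disk disk')+

lemma same_outside:
  assumes "outside t"
  shows "crv K t = crv K' t" "crv K t \<in> cls K \<longleftrightarrow> crv K' t \<in> cls K'"
    "t \<in> ups K \<longleftrightarrow> t \<in> ups K'" "t \<in> bars K \<longleftrightarrow> t \<in> bars K'"
  using same assms unfolding outside_def by blast+

lemma arc_unit: "i < n \<Longrightarrow> t \<in> arc i \<Longrightarrow> t \<in> {0..<1}"
  using arc_bounds[of i] by auto

lemma arc_inj: "i < n \<Longrightarrow> j < n \<Longrightarrow> t \<in> arc i \<Longrightarrow> t \<in> arc j \<Longrightarrow> i = j"
  using arcs_disjoint[of i j] by (cases "i = j") fastforce+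

lemma in_ball: "t \<in> {0..1} \<Longrightarrow> crv K t \<in> ball z r \<longleftrightarrow> (\<exists>i<n. t \<in> arc i)"
  using disk unfolding meets_disk_def by blast

lemma visit_outside:
  assumes "t \<in> visits K c" "c \<notin> ball z r"
  shows "outside t" "t \<in> visits K' c"
proof -
  have t: "t \<in> {0..<1}" "crv K t = c" using assms(1) by (auto simp: visits_def)
  then show o: "outside t" using in_ball[of t] assms(2) unfolding outside_def by auto
  then show "t \<in> visits K' c" using same[of t] t unfolding outside_def visits_def by auto
qed

lemma visits_outside:
  assumes "c \<notin> ball z r"
  shows "visits K c = visits K' c"
  using visit_outside(2)[OF _ assms] local_pair.visit_outside(2)[OF flip _ assms] by blast

lemma cls_outside: "c \<in> cls K - ball z r \<Longrightarrow> c \<in> cls K' - ball z r"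
proof -
  assume c: "c \<in> cls K - ball z r"
  then obtain u where u: "u \<in> visits K c" using K.cls_visits by (metis DiffD1 insertI1)
  then have "outside u" "crv K u = c" using visit_outside(1) c by (auto simp: visits_def)
  then show ?thesis using same[of u] c unfolding outside_def by auto
qed

lemma cls_outside_eq: "cls K - ball z r = cls K' - ball z r"
  using cls_outside local_pair.cls_outside[OF flip] by blast

text \<open>Equality of the curves at \<open>t\<close> is not enough for velocities. Crossings avoid
  the bounding circle, hence \<open>t\<close> has positive distance from the closed arcs. As
  \<open>same\<close> speaks of \<open>{0..1}\<close> only, at \<open>t = 0\<close> the curves are
  compared to the right of \<open>t\<close>; the one-sided derivative determines the velocity since
  both curves are differentiable.\<close>

lemma vel_outside:
  assumes "c \<in> cls K - ball z r" "t \<in> visits K c"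
  shows "vel K t = vel K' t"
proof -
  have t: "t \<in> {0..<1}" "crv K t = c" using assms(2) by (auto simp: visits_def)
  have "c \<notin> sphere z r"
    using assms(1) K.cls_sub_dbl disk unfolding meets_disk_def by blast
  then have "c \<notin> cball z r" using assms(1) by (auto simp: cball_def sphere_def ball_def)
  then have no: "\<forall>i<n. t \<notin> {a i..b i}"
    using t disk unfolding meets_disk_def by force
  \<comment> \<open>Adding \<open>{1..}\<close> keeps the small interval to the right of
    \<open>t\<close> inside the unit interval.\<close>
  define S where "S = (\<Union>i<n. {a i..b i}) \<union> {1..}"
  have "closed S" unfolding S_def by (intro closed_Un closed_UN) auto
  moreover have "t \<notin> S" using no t by (auto simp: S_def)
  ultimately obtain e where e: "e > 0" "ball t e \<subseteq> - S"
    by (meson ComplI open_Compl open_contains_ball)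
  let ?I = "{t..t + e / 2}"
  have eq: "crv K' s = crv K s" if "s \<in> ?I" for s
  proof -
    have "s \<in> ball t e" using that e(1) by (auto simp: dist_real_def)
    then have "s \<notin> S" using e(2) by blast
    then have "\<forall>i<n. s \<notin> {a i..b i}" "s < 1" by (auto simp: S_def)
    then have "outside s" using that t unfolding outside_def by fastforce
    then show ?thesis by (simp add: same_outside(1))
  qed
  have "(crv K has_vector_derivative vel K t) (at t within ?I)"
    using K.differentiable by (rule has_vector_derivative_at_within)
  then have "(crv K' has_vector_derivative vel K t) (at t within ?I)"
    by (rule has_vector_derivative_transform[rotated 2]) (use e(1) eq in auto)
  moreover have "(crv K' has_vector_derivative vel K' t) (at t within ?I)"
    using K'.differentiable by (rule has_vector_derivative_at_within)
  ultimately show ?thesis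
    by (intro vector_derivative_unique_within[of t ?I])
      (use e(1) in \<open>auto simp: trivial_limit_within islimpt_Icc\<close>)
qed

lemma crossing_sign_outside:
  assumes "c \<in> cls K - ball z r"
  shows "crossing_sign K c = crossing_sign K' c"
proof -
  have c: "c \<in> cls K" "c \<in> cls K'" "c \<notin> ball z r" using assms cls_outside by auto
  obtain u v where uv: "visits K c = {u, v}" "u < v" using K.cls_visits c(1) by blast
  then have uv': "visits K' c = {u, v}" using visits_outside c(3) by simp
  have "vel K u = vel K' u" "vel K v = vel K' v"
    using vel_outside[OF assms] uv by auto
  moreover have "u \<in> ups K \<longleftrightarrow> u \<in> ups K'"
    using visit_outside(1)[of u c] uv c same[of u] unfolding outside_def by auto
  ultimately show ?thesis
    using K.crossing_sign_dir[OF c(1) uv(1)] K'.crossing_sign_dir[OF c(2) uv'] uv(2) by simp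
qed

lemma agree_refl: "finite (X \<inter> {0..<1}) \<Longrightarrow> agree X X"
  by (simp add: agree_def)

text \<open>An arc lies either completely below an outside parameter or completely above it. The
  count below is therefore a part outside the arcs, equal for both sets, plus counts over whole
  arcs, equal mod 2.\<close>

lemma low_outside:
  assumes "agree X X'" "outside t"
  shows "low_odd X t = low_odd X' t"
proof -
  \<comment> \<open>The arcs that lie completely below \<open>t\<close>.\<close>
  define I where "I = {i. i < n \<and> b i \<le> t}"
  have fI: "finite I" by (simp add: I_def)
  have card: "card (Y \<inter> {0..<t}) =
      card {s \<in> Y \<inter> {0..<t}. outside s} + (\<Sum>i\<in>I. card (Y \<inter> arc i))"
    if fin: "finite (Y \<inter> {0..<1})" for Y
  proof -
    have t1: "t \<le> 1" using assms(2) by (simp add: outside_def)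
    have eq: "Y \<inter> {0..<t} = {s \<in> Y \<inter> {0..<t}. outside s} \<union> (\<Union>i\<in>I. Y \<inter> arc i)"
    proof (intro equalityI subsetI)
      fix s assume s: "s \<in> Y \<inter> {0..<t}"
      show "s \<in> {s \<in> Y \<inter> {0..<t}. outside s} \<union> (\<Union>i\<in>I. Y \<inter> arc i)"
      proof (cases "outside s")
        case False
        then obtain i where i: "i < n" "s \<in> arc i" using s t1 by (auto simp: outside_def)
        moreover have "t \<notin> arc i" using assms(2) i(1) by (simp add: outside_def)
        ultimately have "i \<in> I" using s by (auto simp: I_def)
        then show ?thesis using i s by blast
      qed (use s in blast)
    next
      fix s assume "s \<in> {s \<in> Y \<inter> {0..<t}. outside s} \<union> (\<Union>i\<in>I. Y \<inter> arc i)"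
      then show "s \<in> Y \<inter> {0..<t}"
      proof
        assume "s \<in> (\<Union>i\<in>I. Y \<inter> arc i)"
        then obtain i where i: "i < n" "b i \<le> t" "s \<in> Y" "s \<in> arc i" by (auto simp: I_def)
        then show ?thesis using arc_bounds[of i] by auto
      qed blast
    qed
    have f: "finite (Y \<inter> arc i)" if "i \<in> I" for i
      using that arc_unit by (intro finite_subset[OF _ fin]) (auto simp: I_def)
    have "card (\<Union>i\<in>I. Y \<inter> arc i) = (\<Sum>i\<in>I. card (Y \<inter> arc i))"
      using f fI arc_inj by (intro card_UN_disjoint) (force simp: I_def)+
    moreover have "finite (\<Union>i\<in>I. Y \<inter> arc i)" using f fI by blast
    moreover have "finite {s \<in> Y \<inter> {0..<t}. outside s}"
      by (rule finite_subset[OF _ fin]) (use t1 in auto)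
    moreover have "{s \<in> Y \<inter> {0..<t}. outside s} \<inter> (\<Union>i\<in>I. Y \<inter> arc i) = {}"
      by (auto simp: outside_def I_def)
    ultimately show ?thesis
      by (subst eq) (simp only: card_Un_disjoint)
  qed
  have "{s \<in> X \<inter> {0..<t}. outside s} = {s \<in> X' \<inter> {0..<t}. outside s}"
    using assms(1) by (auto simp: agree_def)
  moreover have "even (\<Sum>i\<in>I. card (X \<inter> arc i)) \<longleftrightarrow> even (\<Sum>i\<in>I. card (X' \<inter> arc i))"
  proof -
    have "{i \<in> I. odd (card (X \<inter> arc i))} = {i \<in> I. odd (card (X' \<inter> arc i))}"
      using assms(1) by (auto simp: agree_def I_def)
    then show ?thesis using fI by (simp add: even_sum_iff)
  qed
  ultimately show ?thesis
    using card[of X] card[of X'] assms(1) unfolding low_odd_def agree_def by simp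
qed

text \<open>At 1 the count runs over a full period; for the bars this is the total that links the
  two components of a smoothing.\<close>

lemma low_1: "agree X X' \<Longrightarrow> low_odd X 1 = low_odd X' 1"
  by (rule low_outside) (auto simp: outside_def dest!: arc_bounds)

text \<open>The counts below the initial point of the arc agree in parity, and that point belongs to
  both sets or to neither, so only the elements between it and \<open>t\<close> or \<open>t'\<close>
  matter. Two parameters are allowed because a move shifts a crossing along its arc.\<close>

lemma low_arc:
  assumes "agree X X'" "i < n" "t \<in> arc i" "t' \<in> arc i"
  shows "low_odd X t = low_odd X' t' \<longleftrightarrow>
    (odd (card (X \<inter> {a i<..<t})) \<longleftrightarrow> odd (card (X' \<inter> {a i<..<t'})))"
proof -
  have out: "outside (a i)"
  proof -
    have "a i \<notin> arc j" if "j < n" for j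
      using arcs_disjoint[OF assms(2) that] arc_bounds[OF assms(2)] by (cases "j = i") auto
    then show ?thesis using arc_bounds[OF assms(2)] by (auto simp: outside_def)
  qed
  have split: "low_odd Y s \<longleftrightarrow>
      (low_odd Y (a i) \<longleftrightarrow> (odd (card (Y \<inter> {a i<..<s})) \<longleftrightarrow> a i \<in> Y))"
    if fin: "finite (Y \<inter> {0..<1})" and s: "s \<in> arc i" for Y s
  proof -
    have ab: "0 < a i" "a i < s" "s < 1" using s arc_bounds[OF assms(2)] by auto
    have "Y \<inter> {0..<s} = (Y \<inter> {0..<a i}) \<union> ((Y \<inter> {a i<..<s}) \<union> (Y \<inter> {a i}))"
      using ab by auto
    moreover have "finite (Y \<inter> {0..<a i})" "finite (Y \<inter> {a i<..<s})"
      by (rule finite_subset[OF _ fin]; use ab in auto)+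
    moreover have "(Y \<inter> {0..<a i}) \<inter> ((Y \<inter> {a i<..<s}) \<union> (Y \<inter> {a i})) = {}"
      "(Y \<inter> {a i<..<s}) \<inter> (Y \<inter> {a i}) = {}" by auto
    ultimately have
      "card (Y \<inter> {0..<s}) = card (Y \<inter> {0..<a i}) + (card (Y \<inter> {a i<..<s}) + card (Y \<inter> {a i}))"
      by (simp add: card_Un_disjoint)
    then show ?thesis unfolding low_odd_def by (cases "a i \<in> Y") auto
  qed
  have "finite (X \<inter> {0..<1})" "finite (X' \<inter> {0..<1})" "a i \<in> X \<longleftrightarrow> a i \<in> X'"
    using assms(1) out unfolding agree_def by blast+
  then show ?thesis
    using split[OF _ assms(3), of X] split[OF _ assms(4), of X'] low_outside[OF assms(1) out] by blast
qed

lemma low_arc_empty: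
  assumes "agree X X'" "i < n" "t \<in> arc i" "t' \<in> arc i"
    and "X \<inter> arc i \<subseteq> {t}" "X' \<inter> arc i \<subseteq> {t'}"
  shows "low_odd X t = low_odd X' t'"
proof -
  have "X \<inter> {a i<..<t} = {}" "X' \<inter> {a i<..<t'} = {}"
    using assms(3-6) by force+
  then show ?thesis using low_arc[OF assms(1-4)] by simp
qed

text \<open>Passing from the first to the second of two consecutive elements of \<open>X\<close>
  takes in exactly one element, the first itself. This serves both for the bigon of C2 and for the
  three sides of a triangle.\<close>

lemma low_arc_pair:
  assumes "finite (X \<inter> {0..<1})" "i < n" "X \<inter> arc i = {t, t'}" "t \<noteq> t'"
  shows "low_odd X t \<noteq> low_odd X t'"
proof -
  have *: "low_odd X s \<noteq> low_odd X s'" if st: "X \<inter> arc i = {s, s'}" "s < s'" for s s'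
  proof -
    have arc: "s \<in> arc i" "s' \<in> arc i" using st by auto
    have "{a i<..<s} \<subseteq> arc i" "{a i<..<s'} \<subseteq> arc i" using arc by auto
    then have "X \<inter> {a i<..<s} = {s, s'} \<inter> {a i<..<s}" "X \<inter> {a i<..<s'} = {s, s'} \<inter> {a i<..<s'}"
      using st(1) by blast+
    moreover have "{s, s'} \<inter> {a i<..<s} = {}" "{s, s'} \<inter> {a i<..<s'} = {s}"
      using arc st(2) by auto
    ultimately have "X \<inter> {a i<..<s} = {}" "X \<inter> {a i<..<s'} = {s}" by simp_all
    \<comment> \<open>With \<open>X\<close> compared to itself, \<open>low_arc\<close> relates two
      parameters of the same diagram.\<close>
    then show ?thesis using low_arc[OF agree_refl[OF assms(1)] assms(2) arc] by simp
  qed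
  show ?thesis
  proof (cases "t < t'")
    case True
    then show ?thesis using * assms(3) by blast
  next
    case False
    then have "t' < t" "X \<inter> arc i = {t', t}" using assms(3,4) by auto
    then show ?thesis using * by blast
  qed
qed

lemma agree_cls:
  assumes "\<And>i. i < n \<Longrightarrow>
    even (card (cpar K (cls K) \<inter> arc i)) \<longleftrightarrow> even (card (cpar K' (cls K') \<inter> arc i))"
  shows "agree (cpar K (cls K)) (cpar K' (cls K'))"
  unfolding agree_def using assms K.finite_cpar[OF order_refl] K'.finite_cpar[OF order_refl]
  by (simp add: cpar_def same_outside(2))

lemma agree_bars:
  assumes "\<And>i. i < n \<Longrightarrow> even (card (bars K \<inter> arc i)) \<longleftrightarrow> even (card (bars K' \<inter> arc i))"
  shows "agree (bars K) (bars K')"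
  unfolding agree_def using assms K.finite_bars K'.finite_bars by (simp add: same_outside(4))

lemma ZC_outside:
  assumes "agree (cpar K (cls K)) (cpar K' (cls K'))" "c \<in> cls K - ball z r"
  shows "c \<in> ZC K \<longleftrightarrow> c \<in> ZC K'"
proof -
  have c: "c \<in> cls K" "c \<in> cls K'" "c \<notin> ball z r" using assms cls_outside by auto
  obtain u v where uv: "visits K c = {u, v}" "u < v" using K.cls_visits c(1) by blast
  then have uv': "visits K' c = {u, v}" using visits_outside c(3) by simp
  have "outside u" "outside v" using visit_outside(1) c(3) uv by auto
  then show ?thesis
    using ZC_low[OF K.tw_diagram_axioms c(1) uv(1)] ZC_low[OF K'.tw_diagram_axioms c(2) uv'] uv(2)
      low_outside[OF assms(1)] by simp
qed

text \<open>Agreement of the classical passages already determines which crossings outside the disk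
  are zero crossings; what remains to be checked for each move are the zero passages on its
  arcs.\<close>

lemma agree_ZC:
  assumes "agree (cpar K (cls K)) (cpar K' (cls K'))"
    and "\<And>i. i < n \<Longrightarrow>
      even (card (cpar K (ZC K) \<inter> arc i)) \<longleftrightarrow> even (card (cpar K' (ZC K') \<inter> arc i))"
  shows "agree (cpar K (ZC K)) (cpar K' (ZC K'))"
proof -
  have "crv K t \<in> ZC K \<longleftrightarrow> crv K' t \<in> ZC K'" if "outside t" for t
  proof -
    have t: "t \<in> {0..1}" "\<forall>i<n. t \<notin> arc i" using that by (auto simp: outside_def)
    then have s: "crv K t = crv K' t" "crv K t \<in> cls K \<longleftrightarrow> crv K' t \<in> cls K'" using same by blast+
    have "crv K t \<notin> ball z r" using in_ball t by blast
    then show ?thesis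
      using ZC_outside[OF assms(1), of "crv K t"] s K.ZC_sub K'.ZC_sub by (metis DiffI subsetD)
  qed
  then show ?thesis
    unfolding agree_def using assms(2) K.finite_cpar[OF K.ZC_sub] K'.finite_cpar[OF K'.ZC_sub]
    by (simp add: cpar_def)
qed

text \<open>Crossings outside the disk are common to both diagrams and keep sign and weight, so a
  move is reduced to three parity conditions on its arcs and to the crossings in the disk.\<close>

lemma Qz_eq_of_inner:
  assumes P: "agree (cpar K (cls K)) (cpar K' (cls K'))"
    and Z: "agree (cpar K (ZC K)) (cpar K' (ZC K'))"
    and B: "agree (bars K) (bars K')"
    and inner: "(\<Sum>c\<in>cls K \<inter> ball z r. summand K c) = (\<Sum>c\<in>cls K' \<inter> ball z r. summand K' c)"
  shows "Qz K = Qz K'"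
proof -
  have "summand K c = summand K' c" if c: "c \<in> cls K - ball z r" for c
  proof -
    have c': "c \<in> cls K" "c \<in> cls K'" "c \<notin> ball z r" using c cls_outside by auto
    obtain u v where uv: "visits K c = {u, v}" "u < v" using K.cls_visits c'(1) by blast
    then have uv': "visits K' c = {u, v}" using visits_outside c'(3) by simp
    have out: "outside u" "outside v" using visit_outside(1) c'(3) uv by auto
    have ne: "u \<noteq> v" using uv(2) by simp
    have "cweight K c = cweight K' c"
      by (rule cweight_cong_low(2)[OF K.tw_diagram_axioms K'.tw_diagram_axioms c'(1,2) uv(1) ne uv' ne])
        (simp_all only: low_outside[OF P] low_outside[OF Z] low_outside[OF B] out low_1[OF B])
    then show ?thesis by (simp add: summand_def crossing_sign_outside[OF c])
  qed
  then have "(\<Sum>c\<in>cls K - ball z r. summand K c) = (\<Sum>c\<in>cls K' - ball z r. summand K' c)"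
    unfolding cls_outside_eq[symmetric] by (rule sum.cong[OF refl])
  moreover have "Qz K = (\<Sum>c\<in>cls K \<inter> ball z r. summand K c) + (\<Sum>c\<in>cls K - ball z r. summand K c)"
    unfolding K.Qz_eq using K.finite_cls by (rule sum.Int_Diff)
  moreover have "Qz K' = (\<Sum>c\<in>cls K' \<inter> ball z r. summand K' c) + (\<Sum>c\<in>cls K' - ball z r. summand K' c)"
    unfolding K'.Qz_eq using K'.finite_cls by (rule sum.Int_Diff)
  ultimately show ?thesis using inner by simp
qed

lemma meets_arcs:
  assumes "(u, v) \<in> meets K (arc i) (arc j)" "i < n" "j < n"
  shows "u \<in> arc i" "v \<in> arc j" "u \<noteq> v" "crv K v = crv K u" "visits K (crv K u) = {u, v}"
    "crv K u \<in> ball z r" "crv K u \<in> dbl K"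
proof -
  show uv: "u \<in> arc i" "v \<in> arc j" "u \<noteq> v" "crv K v = crv K u"
    using assms(1) by (auto simp: meets_def)
  have "u \<in> {0..<1}" "v \<in> {0..<1}" using arc_unit assms uv by blast+
  then show "visits K (crv K u) = {u, v}" "crv K u \<in> dbl K" using K.visits_of_pair uv by auto
  have "u \<in> {0..1}" using \<open>u \<in> {0..<1}\<close> by auto
  then show "crv K u \<in> ball z r" using in_ball uv(1) assms(2) by blast
qed

text \<open>The other visit to the crossing is at the same point of the disk, and within one period
  the curve is in the open disk exactly on the arcs.\<close>

lemma arc_cls_meets:
  assumes "u \<in> arc i" "i < n" "crv K u \<in> cls K"
  shows "\<exists>j<n. \<exists>v. (u, v) \<in> meets K (arc i) (arc j)"
proof -
  have u: "u \<in> visits K (crv K u)" using arc_unit assms by (auto simp: visits_def)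
  obtain x y where xy: "visits K (crv K u) = {x, y}" "x < y"
    using K.cls_visits assms(3) by metis
  define v where "v = (if u = x then y else x)"
  have v: "v \<in> visits K (crv K u)" "v \<noteq> u" using u xy by (auto simp: v_def)
  have "crv K u \<in> ball z r" using in_ball[of u] assms arc_unit[of i u] by auto
  then have "crv K v \<in> ball z r" using v by (auto simp: visits_def)
  then obtain j where "j < n" "v \<in> arc j" using in_ball[of v] v(1) by (auto simp: visits_def)
  moreover have "crv K u = crv K v" using v by (auto simp: visits_def)
  ultimately show ?thesis using assms(1) v(2) by (auto simp: meets_def)
qed

lemma inner_cls:
  assumes "c \<in> cls K \<inter> ball z r"
  obtains i j u v where "i < n" "j < n" "(u, v) \<in> meets K (arc i) (arc j)" "c = crv K u"
proof -
  obtain u w where u: "visits K c = {u, w}" "0 \<le> u" "u < w" "w < 1" "crv K u = c"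
    using K.cls_visits assms by blast
  then obtain i where "i < n" "u \<in> arc i" using in_ball[of u] assms by auto
  then show thesis using arc_cls_meets[of u i] that u(5) assms by blast
qed

text \<open>Translates the crossings prescribed by the definition of a move, given as sets
  \<open>meets\<close>, into the passages to be counted.\<close>

lemma cpar_arc:
  assumes "S \<subseteq> cls K" "i < n"
  shows "cpar K S \<inter> arc i = {u. \<exists>j<n. \<exists>v. (u, v) \<in> meets K (arc i) (arc j) \<and> crv K u \<in> S}"
  using arc_cls_meets[OF _ assms(2)] assms(1) meets_arcs(1)[OF _ assms(2)]
  unfolding cpar_def by blast

end

section \<open>The moves that replace the part of a diagram in a disk\<close>

lemma local_change_pair:
  assumes "twisted_diagram K" "twisted_diagram K'" "local_change n a b K K'"
  obtains z r where "local_pair K K' n a b z r"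
proof -
  obtain z r where "meets_disk z r n a b K" "meets_disk z r n a b K'"
    using assms(3) unfolding local_change_def by blast
  moreover have "\<And>i. i < n \<Longrightarrow> 0 < a i \<and> a i < b i \<and> b i < 1"
    "\<And>i j. i < n \<Longrightarrow> j < n \<Longrightarrow> i \<noteq> j \<Longrightarrow> {a i..b i} \<inter> {a j..b j} = {}"
    "\<And>t. t \<in> {0..1} \<Longrightarrow> (\<forall>i<n. t \<notin> {a i<..<b i}) \<Longrightarrow>
        crv K t = crv K' t \<and> (crv K t \<in> cls K \<longleftrightarrow> crv K' t \<in> cls K') \<and>
        (t \<in> ups K \<longleftrightarrow> t \<in> ups K') \<and> (t \<in> bars K \<longleftrightarrow> t \<in> bars K')"
    using assms(3) unfolding local_change_def by blast+
  ultimately have "local_pair K K' n a b z r"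
    using assms(1,2) unfolding local_pair_def local_pair_axioms_def tw_diagram_def by blast
  then show thesis by (rule that)
qed

lemma meets_swap: "meets K B A = prod.swap ` meets K A B"
  by (auto simp: meets_def image_iff)

text \<open>A kink adds two passages to its arc or, if it is virtual, none. In the classical case
  its loop has no passages and no bars, so its crossing is a zero crossing with residue 0 and its
  weight vanishes.\<close>

lemma Qz_move1:
  assumes "twisted_diagram K" "twisted_diagram K'" "move1 cl K K'"
  shows "Qz K = Qz K'"
proof -
  obtain a b u v where lc: "local_change 1 a b K K'"
    and pl: "plain_arc K {a 0<..<b 0}" "bars K' \<inter> {a 0<..<b 0} = {}"
    and uv: "u < v" and m: "meets K' {a 0<..<b 0} {a 0<..<b 0} = {(u, v), (v, u)}"
    and cl: "crv K' u \<in> cls K' \<longleftrightarrow> cl"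
    using assms(3) unfolding move1_def Let_def by blast
  obtain z r where "local_pair K K' 1 a b z r" by (rule local_change_pair[OF assms(1,2) lc])
  then interpret local_pair K K' 1 a b z r .
  interpret F: local_pair K' K 1 a b z r by (rule flip)
  have mK: "meets K (arc 0) (arc 0) = {}" and bK: "bars K \<inter> arc 0 = {}"
    using pl(1) by (auto simp: plain_arc_def)
  have "(u, v) \<in> meets K' (arc 0) (arc 0)" using m by simp
  note U = F.meets_arcs[OF this zero_less_one zero_less_one]
  have X: "cpar K S \<inter> arc 0 = {}" if "S \<subseteq> cls K" for S
    using cpar_arc[OF that zero_less_one] mK by simp
  have X': "cpar K' S \<inter> arc 0 = (if crv K' u \<in> S then {u, v} else {})" if "S \<subseteq> cls K'" for S
    using F.cpar_arc[OF that zero_less_one] m U(4) by auto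
  have P: "agree (cpar K (cls K)) (cpar K' (cls K'))"
    by (rule agree_cls) (use uv in \<open>simp add: X X'\<close>)
  have Z: "agree (cpar K (ZC K)) (cpar K' (ZC K'))"
    by (rule agree_ZC[OF P]) (use uv in \<open>simp add: X[OF K.ZC_sub] X'[OF K'.ZC_sub]\<close>)
  have B: "agree (bars K) (bars K')"
    by (rule agree_bars) (simp add: bK pl(2))
  have inK: "cls K \<inter> ball z r = {}"
  proof (rule ccontr)
    assume "cls K \<inter> ball z r \<noteq> {}"
    then obtain c where "c \<in> cls K \<inter> ball z r" by blast
    then show False by (rule inner_cls) (use mK in simp)
  qed
  have "summand K' c = 0" if c: "c \<in> cls K' \<inter> ball z r" for c
  proof -
    obtain i j x y where "i < 1" "j < 1" "(x, y) \<in> meets K' (arc i) (arc j)" "c = crv K' x"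
      using F.inner_cls[OF c] by metis
    then have cu: "c = crv K' u" using m U(4) by auto
    have vis: "visits K' c = {u, v}" using U(5) cu by simp
    \<comment> \<open>Because the arc avoids the base point, the loop over \<open>{u<..<v}\<close>
      is component 0 and not component 1.\<close>
    have sub: "component K' c 0 \<subseteq> arc 0" and nin: "{u, v} \<inter> component K' c 0 = {}"
      using K'.component_eq(1)[OF vis uv] U(1,2) by auto
    have b: "bars K' \<inter> component K' c 0 = {}" using sub pl(2) by blast
    have e: "cpar K' S \<inter> component K' c 0 = {}" if "S \<subseteq> cls K'" for S
    proof -
      have "cpar K' S \<inter> arc 0 \<subseteq> {u, v}" using X'[OF that] by simp
      then show ?thesis using sub nin by blast
    qed
    have "c \<in> ZC K'" using K'.ZC_eq e c by auto
    moreover have "zres K' c = 0" using K'.zres_eq[of c] e K'.ZC_sub c by auto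
    moreover have "bar_parity K' c 0 = 0" using b by (simp add: bar_parity_def)
    ultimately show ?thesis by (simp add: summand_def cweight_def sdeg_def)
  qed
  then show ?thesis by (intro Qz_eq_of_inner[OF P Z B]) (simp add: inK)
qed

text \<open>The two crossings of the bigon cancel: the same arc is over at both, the directions are
  opposite, and the weights are equal because the parities change on both strands together from one
  crossing to the other.\<close>

lemma Qz_move2:
  assumes "twisted_diagram K" "twisted_diagram K'" "move2 cl K K'"
  shows "Qz K = Qz K'"
proof -
  obtain a b u v u' v' where lc: "local_change 2 a b K K'"
    and pl: "plain_arc K {a 0<..<b 0}" "plain_arc K {a 1<..<b 1}"
      "plain_arc K' {a 0<..<b 0}" "plain_arc K' {a 1<..<b 1}"
    and m0: "meets K {a 0<..<b 0} {a 1<..<b 1} = {}" and ne: "u \<noteq> u'"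
    and m: "meets K' {a 0<..<b 0} {a 1<..<b 1} = {(u, v), (u', v')}"
    and cl: "crv K' u \<in> cls K' \<longleftrightarrow> cl" "crv K' u' \<in> cls K' \<longleftrightarrow> cl"
    and ups: "u \<in> ups K' \<longleftrightarrow> u' \<in> ups K'" and dir: "dir K' u v = - dir K' u' v'"
    using assms(3) unfolding move2_def Let_def by blast
  obtain z r where "local_pair K K' 2 a b z r" by (rule local_change_pair[OF assms(1,2) lc])
  then interpret local_pair K K' 2 a b z r .
  interpret F: local_pair K' K 2 a b z r by (rule flip)
  have one_lt_two: "1 < (2 :: nat)" by simp
  have two: "i < 2 \<longleftrightarrow> i = 0 \<or> i = 1" for i :: nat by auto
  have ex_two: "(\<exists>i<2. Q i) \<longleftrightarrow> Q 0 \<or> Q 1" for Q :: "nat \<Rightarrow> bool" by (auto simp: two)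
  have mK: "meets K (arc i) (arc j) = {}" if "i < 2" "j < 2" for i j
    using pl(1,2) m0 meets_swap[of K "arc 1" "arc 0"] that unfolding two plain_arc_def by auto
  have bK: "bars K \<inter> arc i = {}" "bars K' \<inter> arc i = {}" if "i < 2" for i
    using pl that unfolding two plain_arc_def by auto
  have mK': "meets K' (arc 0) (arc 0) = {}" "meets K' (arc 1) (arc 1) = {}"
    "meets K' (arc 1) (arc 0) = {(v, u), (v', u')}"
    using pl(3,4) m meets_swap[of K' "arc 1" "arc 0"] unfolding plain_arc_def by auto
  have "(u, v) \<in> meets K' (arc 0) (arc 1)" "(u', v') \<in> meets K' (arc 0) (arc 1)" using m by simp_all
  note U = F.meets_arcs[OF this(1) pos2 one_lt_two]
    and U' = F.meets_arcs[OF this(2) pos2 one_lt_two]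
  \<comment> \<open>Needed to see that the bigon has two different corners, so that the inner sum
    really has two terms.\<close>
  have "u' \<noteq> v" using arc_inj[of 0 1 v] U(2) U'(1) by auto
  then have cne: "crv K' u \<noteq> crv K' u'" using U(5) U'(5) ne by (auto simp: doubleton_eq_iff)
  then have vne: "v \<noteq> v'" using U(4) U'(4) by auto
  have X: "cpar K S \<inter> arc i = {}" if "S \<subseteq> cls K" "i < 2" for S i
    unfolding cpar_arc[OF that] using mK[OF that(2)] by blast
  have X': "cpar K' S \<inter> arc 0 = {x \<in> {u, u'}. crv K' x \<in> S}"
      "cpar K' S \<inter> arc 1 = {x \<in> {v, v'}. crv K' x \<in> S}" if "S \<subseteq> cls K'" for S
    unfolding F.cpar_arc[OF that pos2] F.cpar_arc[OF that one_lt_two] ex_two m mK'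
    using U(4) U'(4) by auto
  have X'2: "cpar K' S \<inter> arc 0 = (if crv K' u \<in> S then {u, u'} else {})"
      "cpar K' S \<inter> arc 1 = (if crv K' u \<in> S then {v, v'} else {})"
    if "S \<subseteq> cls K'" "crv K' u \<in> S \<longleftrightarrow> crv K' u' \<in> S" for S
    unfolding X'[OF that(1)] using that(2) U(4) U'(4) by auto
  have ev: "even (card (cpar K S \<inter> arc i)) \<longleftrightarrow> even (card (cpar K' S' \<inter> arc i))"
    if "S \<subseteq> cls K" "S' \<subseteq> cls K'" "crv K' u \<in> S' \<longleftrightarrow> crv K' u' \<in> S'" "i < 2" for S S' i
  proof -
    have "i = 0 \<or> i = 1" using that(4) by (simp add: two)
    then have "even (card (cpar K' S' \<inter> arc i))"
      using X'2[OF that(2,3)] ne vne by (elim disjE) simp_all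
    then show ?thesis by (simp add: X[OF that(1,4)])
  qed
  have P: "agree (cpar K (cls K)) (cpar K' (cls K'))"
    by (rule agree_cls) (use ev cl in blast)
  \<comment> \<open>Between the two corners each strand passes exactly one element of the set, so
    both values of \<open>low_odd\<close> are reversed.\<close>
  have low: "(low_odd (cpar K' S) u = low_odd (cpar K' S) v) =
      (low_odd (cpar K' S) u' = low_odd (cpar K' S) v')"
    if S: "S \<subseteq> cls K'" "crv K' u \<in> S" "crv K' u' \<in> S" for S
  proof -
    have "low_odd (cpar K' S) u \<noteq> low_odd (cpar K' S) u'" "low_odd (cpar K' S) v \<noteq> low_odd (cpar K' S) v'"
      using low_arc_pair[OF K'.finite_cpar[OF S(1)], of 0 u u'] low_arc_pair[OF K'.finite_cpar[OF S(1)], of 1 v v']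
        X'2[OF S(1)] S(2,3) ne vne by auto
    then show ?thesis by blast
  qed
  have ZC: "crv K' u \<in> ZC K' \<longleftrightarrow> crv K' u' \<in> ZC K'"
  proof (cases cl)
    case True
    then show ?thesis
      using ZC_low[OF K'.tw_diagram_axioms _ U(5,3)] ZC_low[OF K'.tw_diagram_axioms _ U'(5,3)]
        low[OF order_refl] cl by blast
  next
    case False
    then show ?thesis using cl K'.ZC_sub by blast
  qed
  have Z: "agree (cpar K (ZC K)) (cpar K' (ZC K'))"
    by (rule agree_ZC[OF P]) (use ev ZC K.ZC_sub K'.ZC_sub in blast)
  have B: "agree (bars K) (bars K')"
    by (rule agree_bars) (simp add: bK)
  have inK: "cls K \<inter> ball z r = {}"
  proof (rule ccontr)
    assume "cls K \<inter> ball z r \<noteq> {}"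
    then obtain c where "c \<in> cls K \<inter> ball z r" by blast
    then show False by (rule inner_cls) (use mK in simp)
  qed
  have inK': "cls K' \<inter> ball z r = (if cl then {crv K' u, crv K' u'} else {})"
  proof -
    have only: "c = crv K' u \<or> c = crv K' u'" if c: "c \<in> cls K' \<inter> ball z r" for c
    proof -
      obtain i j x y where ij: "i < 2" "j < 2" and xy: "(x, y) \<in> meets K' (arc i) (arc j)" "c = crv K' x"
        using F.inner_cls[OF c] by metis
      then show ?thesis using m mK' U(4) U'(4) unfolding two by auto
    qed
    show ?thesis
    proof (cases cl)
      case True
      then have "cls K' \<inter> ball z r = {crv K' u, crv K' u'}" using only cl U(6) U'(6) by blast
      then show ?thesis using True by simp
    next
      case False
      then have "cls K' \<inter> ball z r = {}" using only cl by blast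
      then show ?thesis using False by simp
    qed
  qed
  have "(\<Sum>c\<in>cls K' \<inter> ball z r. summand K' c) = 0"
  proof (cases cl)
    case True
    then have c: "crv K' u \<in> cls K'" "crv K' u' \<in> cls K'" using cl by auto
    have Bu: "low_odd (bars K') u = low_odd (bars K') u'" "low_odd (bars K') v = low_odd (bars K') v'"
      using low_arc_empty[OF agree_refl[OF K'.finite_bars], of 0 u u']
        low_arc_empty[OF agree_refl[OF K'.finite_bars], of 1 v v'] bK U(1,2) U'(1,2) by auto
    have "cweight K' (crv K' u) = cweight K' (crv K' u')"
      by (rule cweight_cong_low(2)[OF K'.tw_diagram_axioms K'.tw_diagram_axioms c U(5,3) U'(5,3)])
        (use low[OF order_refl c] low[OF K'.ZC_sub] ZC Bu in auto)
    moreover have "crossing_sign K' (crv K' u) = - crossing_sign K' (crv K' u')"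
      using K'.crossing_sign_dir[OF c(1) U(5,3)] K'.crossing_sign_dir[OF c(2) U'(5,3)]
        K'.turn_nonzero[OF c(1) U(5,3)] K'.turn_nonzero[OF c(2) U'(5,3)] ups dir
      by (auto simp: sgn_if split: if_splits)
    ultimately show ?thesis using cne inK' True by (simp add: summand_def)
  qed (simp add: inK')
  then show ?thesis by (intro Qz_eq_of_inner[OF P Z B]) (simp add: inK)
qed

text \<open>The virtual crossings add no passages, so \<open>c\<close> takes the place of
  \<open>u\<close> on the first arc and \<open>c'\<close> that of \<open>v\<close> on the second.
  Removing the bars reverses the parity of the bars below both strands, which leaves every
  comparison of the two strands unchanged.\<close>

lemma Qz_move_T3:
  assumes "twisted_diagram K" "twisted_diagram K'" "move_T3 K K'"
  shows "Qz K = Qz K'"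
proof -
  obtain a b u v p p' q q' c c' where lc: "local_change 2 a b K K'"
    and pl: "meets K {a 0<..<b 0} {a 0<..<b 0} = {}" "meets K {a 1<..<b 1} {a 1<..<b 1} = {}"
      "plain_arc K' {a 0<..<b 0}" "plain_arc K' {a 1<..<b 1}"
    and m: "meets K {a 0<..<b 0} {a 1<..<b 1} = {(u, v)}" and clu: "crv K u \<in> cls K"
    and br: "card (bars K \<inter> {a 0<..<u}) = 1" "card (bars K \<inter> {u<..<b 0}) = 1"
      "card (bars K \<inter> {a 1<..<v}) = 1" "card (bars K \<inter> {v<..<b 1}) = 1"
    and m': "meets K' {a 0<..<b 0} {a 1<..<b 1} = {(p, p'), (c, c'), (q, q')}"
    and cls: "crv K' p \<notin> cls K'" "crv K' c \<in> cls K'" "crv K' q \<notin> cls K'"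
    and sign: "crossing_sign K' (crv K' c) = crossing_sign K (crv K u)"
    using assms(3) unfolding move_T3_def Let_def by (elim exE conjE) (rule that; assumption)
  obtain z r where "local_pair K K' 2 a b z r" by (rule local_change_pair[OF assms(1,2) lc])
  then interpret local_pair K K' 2 a b z r .
  interpret F: local_pair K' K 2 a b z r by (rule flip)
  have one_lt_two: "1 < (2 :: nat)" by simp
  have two: "i < 2 \<longleftrightarrow> i = 0 \<or> i = 1" for i :: nat by auto
  have ex_two: "(\<exists>i<2. Q i) \<longleftrightarrow> Q 0 \<or> Q 1" for Q :: "nat \<Rightarrow> bool" by (auto simp: two)
  have mK: "meets K (arc 0) (arc 0) = {}" "meets K (arc 1) (arc 1) = {}"
    "meets K (arc 1) (arc 0) = {(v, u)}"
    using pl(1,2) m meets_swap[of K "arc 1" "arc 0"] by auto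
  have mK': "meets K' (arc 0) (arc 0) = {}" "meets K' (arc 1) (arc 1) = {}"
    "meets K' (arc 1) (arc 0) = {(p', p), (c', c), (q', q)}"
    using pl(3,4) m' meets_swap[of K' "arc 1" "arc 0"] unfolding plain_arc_def by auto
  have bK': "bars K' \<inter> arc i = {}" if "i < 2" for i
    using pl(3,4) that unfolding two plain_arc_def by auto
  have "(u, v) \<in> meets K (arc 0) (arc 1)" using m by simp
  note U = meets_arcs[OF this pos2 one_lt_two]
  have "(c, c') \<in> meets K' (arc 0) (arc 1)" "(p, p') \<in> meets K' (arc 0) (arc 1)"
    "(q, q') \<in> meets K' (arc 0) (arc 1)" using m' by simp_all
  note C = F.meets_arcs[OF this(1) pos2 one_lt_two]
    and crv_pq = F.meets_arcs(4)[OF this(2) pos2 one_lt_two] F.meets_arcs(4)[OF this(3) pos2 one_lt_two]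
  have X: "cpar K S \<inter> arc 0 = (if crv K u \<in> S then {u} else {})"
      "cpar K S \<inter> arc 1 = (if crv K u \<in> S then {v} else {})" if "S \<subseteq> cls K" for S
    unfolding cpar_arc[OF that pos2] cpar_arc[OF that one_lt_two] ex_two m mK
    using U(4) by auto
  have X': "cpar K' S \<inter> arc 0 = (if crv K' c \<in> S then {c} else {})"
      "cpar K' S \<inter> arc 1 = (if crv K' c \<in> S then {c'} else {})" if "S \<subseteq> cls K'" for S
    unfolding F.cpar_arc[OF that pos2] F.cpar_arc[OF that one_lt_two] ex_two m' mK'
    using C(4) crv_pq cls subsetD[OF that] by auto
  have ev: "even (card (cpar K S \<inter> arc i)) \<longleftrightarrow> even (card (cpar K' S' \<inter> arc i))"
    if "S \<subseteq> cls K" "S' \<subseteq> cls K'" "crv K u \<in> S \<longleftrightarrow> crv K' c \<in> S'" "i < 2" for S S' i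
  proof -
    have "i = 0 \<or> i = 1" using that(4) by (simp add: two)
    then show ?thesis using X[OF that(1)] X'[OF that(2)] that(3) by (elim disjE) simp_all
  qed
  have P: "agree (cpar K (cls K)) (cpar K' (cls K'))"
    by (rule agree_cls) (use ev cls clu in blast)
  have low: "low_odd (cpar K S) u = low_odd (cpar K' S') c" "low_odd (cpar K S) v = low_odd (cpar K' S') c'"
    if "agree (cpar K S) (cpar K' S')" "S \<subseteq> cls K" "S' \<subseteq> cls K'" for S S'
    using low_arc_empty[OF that(1), of 0 u c] low_arc_empty[OF that(1), of 1 v c']
      X[OF that(2)] X'[OF that(3)] U(1,2) C(1,2) by auto
  have ZC: "crv K u \<in> ZC K \<longleftrightarrow> crv K' c \<in> ZC K'"
    using ZC_low[OF K.tw_diagram_axioms clu U(5,3)] ZC_low[OF K'.tw_diagram_axioms cls(2) C(5,3)]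
      low[OF P] by blast
  have Z: "agree (cpar K (ZC K)) (cpar K' (ZC K'))"
    by (rule agree_ZC[OF P]) (use ev ZC K.ZC_sub K'.ZC_sub in blast)
  have nb: "u \<notin> bars K" "v \<notin> bars K" using K.bars_not_dbl[of u] K.bars_not_dbl[of v] U(4,7) by auto
  \<comment> \<open>One bar on each side of the crossing and none at the crossing itself makes two
    bars on the arc.\<close>
  have evb: "even (card (bars K \<inter> {x<..<y}))"
    if "card (bars K \<inter> {x<..<w}) = 1" "card (bars K \<inter> {w<..<y}) = 1" "w \<notin> bars K" "w \<in> {x<..<y}" for x y w
  proof -
    have "bars K \<inter> {x<..<y} = (bars K \<inter> {x<..<w}) \<union> (bars K \<inter> {w<..<y})"
      using that(3,4) by (auto simp: neq_iff) (metis neqE)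
    moreover have "finite (bars K \<inter> {x<..<w})" "finite (bars K \<inter> {w<..<y})"
      using that(1,2) by (metis card.infinite zero_neq_one)+
    moreover have "(bars K \<inter> {x<..<w}) \<inter> (bars K \<inter> {w<..<y}) = {}" by auto
    ultimately show ?thesis using that(1,2) by (simp only: card_Un_disjoint) simp
  qed
  have B: "agree (bars K) (bars K')"
    by (rule agree_bars) (use evb[OF br(1,2) nb(1) U(1)] evb[OF br(3,4) nb(2) U(2)] bK' in \<open>auto simp: two\<close>)
  have b0: "bars K' \<inter> {a 0<..<c} = {}" "bars K' \<inter> {a 1<..<c'} = {}"
    using bK'[of 0] bK'[of 1] C(1,2) by force+
  \<comment> \<open>Exactly one bar precedes the crossing on each arc of \<open>K\<close>, and none
    does in \<open>K'\<close>.\<close>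
  have lowB: "low_odd (bars K) u \<noteq> low_odd (bars K') c" "low_odd (bars K) v \<noteq> low_odd (bars K') c'"
    using low_arc[OF B, of 0 u c] low_arc[OF B, of 1 v c'] U(1,2) C(1,2) br b0 by auto
  have inK: "cls K \<inter> ball z r = {crv K u}"
  proof -
    have "d = crv K u" if d: "d \<in> cls K \<inter> ball z r" for d
    proof -
      obtain i j x y where ij: "i < 2" "j < 2" and xy: "(x, y) \<in> meets K (arc i) (arc j)" "d = crv K x"
        using inner_cls[OF d] by metis
      then show ?thesis using m mK U(4) unfolding two by auto
    qed
    then show ?thesis using clu U(6) by blast
  qed
  have inK': "cls K' \<inter> ball z r = {crv K' c}"
  proof -
    have "d = crv K' c" if d: "d \<in> cls K' \<inter> ball z r" for d
    proof -
      obtain i j x y where ij: "i < 2" "j < 2" and xy: "(x, y) \<in> meets K' (arc i) (arc j)" "d = crv K' x"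
        using F.inner_cls[OF d] by metis
      then show ?thesis using m' mK' C(4) crv_pq cls d unfolding two by auto
    qed
    then show ?thesis using cls(2) C(6) by blast
  qed
  have "cweight K (crv K u) = cweight K' (crv K' c)"
    by (rule cweight_cong_low(2)[OF K.tw_diagram_axioms K'.tw_diagram_axioms clu cls(2) U(5,3) C(5,3)])
      (use low[OF P] low[OF Z K.ZC_sub K'.ZC_sub] lowB low_1[OF B] in auto)
  then show ?thesis by (intro Qz_eq_of_inner[OF P Z B]) (simp add: inK inK' summand_def sign)
qed

text \<open>
  The last hypothesis says that the triangle does not have exactly two classical crossings: this
  is what C3, V3 and V4 have in common, and it fails for the forbidden moves.
\<close>

lemma Qz_triangle_move:
  assumes "twisted_diagram K" "twisted_diagram K'" "triangle_move u u' K K'"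
    and trans: "\<And>i j k. i < 3 \<Longrightarrow> j < 3 \<Longrightarrow> k < 3 \<Longrightarrow> i \<noteq> j \<Longrightarrow> j \<noteq> k \<Longrightarrow> i \<noteq> k \<Longrightarrow>
      crv K (u i j) \<in> cls K \<Longrightarrow> crv K (u i k) \<in> cls K \<Longrightarrow> crv K (u j k) \<in> cls K"
  shows "Qz K = Qz K'"
proof -
  obtain a b where lc: "local_change 3 a b K K'" and tr: "triangle a b u K" "triangle a b u' K'"
    using assms(3) unfolding triangle_move_def by (elim conjE exE) (rule that; assumption)
  note all = assms(3)[unfolded triangle_move_def, THEN conjunct2]
  have order: "u i j < u i k \<longleftrightarrow> u' i k < u' i j"
    if "i < 3" "j < 3" "k < 3" "i \<noteq> j" "j \<noteq> k" "i \<noteq> k" for i j k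
    using all[THEN conjunct1] that by simp
  have corr: "crv K (u i j) \<in> cls K \<longleftrightarrow> crv K' (u' i j) \<in> cls K'" "u i j \<in> ups K \<longleftrightarrow> u' i j \<in> ups K'"
    "dir K (u i j) (u j i) = dir K' (u' i j) (u' j i)" if "i < 3" "j < 3" "i \<noteq> j" for i j
    using all[THEN conjunct2] that by simp_all
  obtain z r where "local_pair K K' 3 a b z r" by (rule local_change_pair[OF assms(1,2) lc])
  then interpret local_pair K K' 3 a b z r .
  interpret F: local_pair K' K 3 a b z r by (rule flip)
  have mK: "meets K (arc i) (arc j) = (if i = j then {} else {(u i j, u j i)})"
    "meets K' (arc i) (arc j) = (if i = j then {} else {(u' i j, u' j i)})"
    if "i < 3" "j < 3" for i j
    using tr that unfolding triangle_def plain_arc_def by (cases "i = j"; simp)+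
  have bK: "bars K \<inter> arc i = {}" "bars K' \<inter> arc i = {}" if "i < 3" for i
    using tr that unfolding triangle_def plain_arc_def by simp_all
  have "(u i j, u j i) \<in> meets K (arc i) (arc j)" "(u' i j, u' j i) \<in> meets K' (arc i) (arc j)"
    if "i < 3" "j < 3" "i \<noteq> j" for i j
    using mK[OF that(1,2)] that(3) by auto
  note U = meets_arcs[OF this(1)] and U' = F.meets_arcs[OF this(2)]
  have third: "\<exists>k<3. k \<noteq> i \<and> k \<noteq> j"
    if "i < 3" "j < 3" "i \<noteq> j" for i j :: nat
    using that by presburger
  have inj: "u i j \<noteq> u i k" and inj': "u' i j \<noteq> u' i k"
    if "i < 3" "j < 3" "k < 3" "i \<noteq> j" "i \<noteq> k" "j \<noteq> k" for i j k
  proof -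
    show "u i j \<noteq> u i k"
    proof
      assume eq: "u i j = u i k"
      then have "{u i j, u j i} = {u i j, u k i}" using U(5)[of i j] U(5)[of i k] that by simp
      then have "u j i = u k i" using U(3)[of i j] U(3)[of i k] that eq by (auto simp: doubleton_eq_iff)
      then show False using arc_inj[of j k "u j i"] U(2)[of i j] U(2)[of i k] that by simp
    qed
    show "u' i j \<noteq> u' i k"
    proof
      assume eq: "u' i j = u' i k"
      then have "{u' i j, u' j i} = {u' i j, u' k i}" using U'(5)[of i j] U'(5)[of i k] that by simp
      then have "u' j i = u' k i" using U'(3)[of i j] U'(3)[of i k] that eq by (auto simp: doubleton_eq_iff)
      then show False using arc_inj[of j k "u' j i"] U'(2)[of i j] U'(2)[of i k] that by simp
    qed
  qed
  have X: "cpar K S \<inter> arc i = u i ` {j. j < 3 \<and> j \<noteq> i \<and> crv K (u i j) \<in> S}"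
    if "S \<subseteq> cls K" "i < 3" for S i
    using cpar_arc[OF that] mK(1)[OF that(2)] by (auto split: if_splits)
  have X': "cpar K' S \<inter> arc i = u' i ` {j. j < 3 \<and> j \<noteq> i \<and> crv K' (u' i j) \<in> S}"
    if "S \<subseteq> cls K'" "i < 3" for S i
    using F.cpar_arc[OF that] mK(2)[OF that(2)] by (auto split: if_splits)
  have ev: "even (card (cpar K S \<inter> arc i)) \<longleftrightarrow> even (card (cpar K' S' \<inter> arc i))"
    if S: "S \<subseteq> cls K" "S' \<subseteq> cls K'"
      and corrS: "\<And>i j. i < 3 \<Longrightarrow> j < 3 \<Longrightarrow> i \<noteq> j \<Longrightarrow> crv K (u i j) \<in> S \<longleftrightarrow> crv K' (u' i j) \<in> S'"
      and i: "i < 3" for S S' i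
  proof -
    let ?J = "{j. j < 3 \<and> j \<noteq> i \<and> crv K (u i j) \<in> S}"
    have J: "?J = {j. j < 3 \<and> j \<noteq> i \<and> crv K' (u' i j) \<in> S'}" using corrS i by blast
    have "inj_on (u i) ?J" "inj_on (u' i) ?J"
      using inj inj' i by (auto simp: inj_on_def) metis+
    then show ?thesis unfolding X[OF S(1) i] X'[OF S(2) i] J[symmetric] by (simp add: card_image)
  qed
  \<comment> \<open>The move carries the passage \<open>u i k\<close> from one side of
    \<open>u i j\<close> to the other, so the count below \<open>u i j\<close> on its arc changes
    exactly when that passage is counted.\<close>
  have low1: "low_odd (cpar K S) (u i j) = low_odd (cpar K' S') (u' i j) \<longleftrightarrow> crv K (u i k) \<notin> S"
    if S: "S \<subseteq> cls K" "S' \<subseteq> cls K'" "agree (cpar K S) (cpar K' S')"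
      and corrS: "\<And>i j. i < 3 \<Longrightarrow> j < 3 \<Longrightarrow> i \<noteq> j \<Longrightarrow> crv K (u i j) \<in> S \<longleftrightarrow> crv K' (u' i j) \<in> S'"
      and ijk: "i < 3" "j < 3" "k < 3" "i \<noteq> j" "j \<noteq> k" "i \<noteq> k" for S S' i j k
  proof -
    have arcs: "u i j \<in> arc i" "u' i j \<in> arc i" "u i k \<in> arc i" "u' i k \<in> arc i"
      using U(1) U'(1) ijk by simp_all
    have only: "l = j \<or> l = k" if "l < 3" "l \<noteq> i" for l using that ijk by presburger
    have "cpar K S \<inter> {a i<..<u i j} = (cpar K S \<inter> arc i) \<inter> {..<u i j}" using arcs by auto
    also have "\<dots> = (if crv K (u i k) \<in> S \<and> u i k < u i j then {u i k} else {})"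
      unfolding X[OF S(1) ijk(1)] using only ijk by auto
    finally have e: "odd (card (cpar K S \<inter> {a i<..<u i j})) \<longleftrightarrow> crv K (u i k) \<in> S \<and> u i k < u i j"
      by simp
    have "cpar K' S' \<inter> {a i<..<u' i j} = (cpar K' S' \<inter> arc i) \<inter> {..<u' i j}" using arcs by auto
    also have "\<dots> = (if crv K' (u' i k) \<in> S' \<and> u' i k < u' i j then {u' i k} else {})"
      unfolding X'[OF S(2) ijk(1)] using only ijk by auto
    finally have e': "odd (card (cpar K' S' \<inter> {a i<..<u' i j})) \<longleftrightarrow>
        crv K' (u' i k) \<in> S' \<and> u' i k < u' i j"
      by simp
    have "u' i k < u' i j \<longleftrightarrow> \<not> u i k < u i j"
      using order[OF ijk] inj[of i j k] ijk by auto
    then show ?thesis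
      using low_arc[OF S(3) ijk(1) arcs(1,2)] e e' corrS[of i k] ijk by blast
  qed
  have sym: "crv K (u j i) = crv K (u i j)" "crv K' (u' j i) = crv K' (u' i j)"
    if "i < 3" "j < 3" "i \<noteq> j" for i j
    using U(4) U'(4) that by simp_all
  \<comment> \<open>The crossing of \<open>i\<close> and \<open>j\<close> is in \<open>S\<close>. As
    \<open>S\<close> never contains exactly two of the three corners, it contains both or neither of
    the others, so the values on the two strands change together.\<close>
  have low: "(low_odd (cpar K S) (u i j) = low_odd (cpar K S) (u j i)) =
      (low_odd (cpar K' S') (u' i j) = low_odd (cpar K' S') (u' j i))"
    if S: "S \<subseteq> cls K" "S' \<subseteq> cls K'" "agree (cpar K S) (cpar K' S')"
      and corrS: "\<And>i j. i < 3 \<Longrightarrow> j < 3 \<Longrightarrow> i \<noteq> j \<Longrightarrow> crv K (u i j) \<in> S \<longleftrightarrow> crv K' (u' i j) \<in> S'"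
      and transS: "\<And>i j k. i < 3 \<Longrightarrow> j < 3 \<Longrightarrow> k < 3 \<Longrightarrow> i \<noteq> j \<Longrightarrow> j \<noteq> k \<Longrightarrow> i \<noteq> k \<Longrightarrow>
        crv K (u i j) \<in> S \<Longrightarrow> crv K (u i k) \<in> S \<Longrightarrow> crv K (u j k) \<in> S"
      and ij: "i < 3" "j < 3" "i \<noteq> j" "crv K (u i j) \<in> S" for S S' i j
  proof -
    obtain k where k: "k < 3" "k \<noteq> i" "k \<noteq> j" using third[OF ij(1-3)] by blast
    have "crv K (u j i) \<in> S" using sym ij by simp
    then have "crv K (u i k) \<in> S \<longleftrightarrow> crv K (u j k) \<in> S"
      using transS[of i j k] transS[of j i k] ij k by blast
    then show ?thesis
      using low1[OF S corrS, of i j k] low1[OF S corrS, of j i k] ij k by blast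
  qed
  have P: "agree (cpar K (cls K)) (cpar K' (cls K'))"
    by (rule agree_cls) (rule ev[OF order_refl order_refl corr(1)])
  have lowP: "(low_odd (cpar K (cls K)) (u i j) = low_odd (cpar K (cls K)) (u j i)) =
      (low_odd (cpar K' (cls K')) (u' i j) = low_odd (cpar K' (cls K')) (u' j i))"
    if "i < 3" "j < 3" "i \<noteq> j" "crv K (u i j) \<in> cls K" for i j
    by (rule low[OF order_refl order_refl P]) (fact that corr(1) trans)+
  have ZCu: "crv K (u i j) \<in> ZC K \<longleftrightarrow>
      low_odd (cpar K (cls K)) (u i j) \<noteq> low_odd (cpar K (cls K)) (u j i)"
    if "i < 3" "j < 3" "i \<noteq> j" "crv K (u i j) \<in> cls K" for i j
    using ZC_low[OF K.tw_diagram_axioms that(4) U(5,3)] that by simp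
  have corrZ: "crv K (u i j) \<in> ZC K \<longleftrightarrow> crv K' (u' i j) \<in> ZC K'" if ij: "i < 3" "j < 3" "i \<noteq> j" for i j
  proof (cases "crv K (u i j) \<in> cls K")
    case True
    then have "crv K' (u' i j) \<in> cls K'" using corr(1) ij by blast
    then have "crv K' (u' i j) \<in> ZC K' \<longleftrightarrow>
        low_odd (cpar K' (cls K')) (u' i j) \<noteq> low_odd (cpar K' (cls K')) (u' j i)"
      using ZC_low[OF K'.tw_diagram_axioms _ U'(5,3)] ij by simp
    then show ?thesis using ZCu[OF ij True] lowP[OF ij True] by blast
  next
    case False
    then show ?thesis using corr(1)[OF ij] K.ZC_sub K'.ZC_sub by blast
  qed
  \<comment> \<open>With three classical crossings, each of the three pairs of neighbouring passages contributes
    1 to the sum of the three affine indices mod 2, so an even number of the crossings is odd.\<close>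
  have transZ: "crv K (u j k) \<in> ZC K"
    if ijk: "i < 3" "j < 3" "k < 3" "i \<noteq> j" "j \<noteq> k" "i \<noteq> k"
      and z: "crv K (u i j) \<in> ZC K" "crv K (u i k) \<in> ZC K" for i j k
  proof -
    have c: "crv K (u i j) \<in> cls K" "crv K (u i k) \<in> cls K" using z K.ZC_sub by blast+
    then have c': "crv K (u j k) \<in> cls K" using trans ijk by blast
    have pair: "low_odd (cpar K (cls K)) (u l x) \<noteq> low_odd (cpar K (cls K)) (u l y)"
      if l: "l < 3" "x < 3" "y < 3" "l \<noteq> x" "l \<noteq> y" "x \<noteq> y"
        "crv K (u l x) \<in> cls K" "crv K (u l y) \<in> cls K" for l x y
    proof -
      have "{m. m < 3 \<and> m \<noteq> l \<and> crv K (u l m) \<in> cls K} = {x, y}" using l by auto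
      then have "cpar K (cls K) \<inter> arc l = {u l x, u l y}" using X[OF order_refl l(1)] by simp
      then show ?thesis
        using low_arc_pair[OF K.finite_cpar[OF order_refl] l(1)] inj l by blast
    qed
    have "crv K (u j i) \<in> cls K" "crv K (u k i) \<in> cls K" "crv K (u k j) \<in> cls K"
      using c c' sym ijk by simp_all
    then have "low_odd (cpar K (cls K)) (u i j) \<noteq> low_odd (cpar K (cls K)) (u i k)"
      "low_odd (cpar K (cls K)) (u j i) \<noteq> low_odd (cpar K (cls K)) (u j k)"
      "low_odd (cpar K (cls K)) (u k i) \<noteq> low_odd (cpar K (cls K)) (u k j)"
      using pair[of i j k] pair[of j i k] pair[of k i j] c c' ijk by simp_all
    \<comment> \<open>The six passages form a hexagon whose edges join passages consecutive on an
      arc or passages of the same crossing. Five edges are known to join different values, and in a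
      cycle of even length the sixth must do so too.\<close>
    then show ?thesis
      using ZCu[of i j] ZCu[of i k] ZCu[of j k] z c c' ijk by blast
  qed
  have Z: "agree (cpar K (ZC K)) (cpar K' (ZC K'))"
    by (rule agree_ZC[OF P]) (rule ev[OF K.ZC_sub K'.ZC_sub corrZ])
  have lowZ: "(low_odd (cpar K (ZC K)) (u i j) = low_odd (cpar K (ZC K)) (u j i)) =
      (low_odd (cpar K' (ZC K')) (u' i j) = low_odd (cpar K' (ZC K')) (u' j i))"
    if "i < 3" "j < 3" "i \<noteq> j" "crv K (u i j) \<in> ZC K" for i j
    by (rule low[OF K.ZC_sub K'.ZC_sub Z]) (fact that corrZ transZ)+
  have B: "agree (bars K) (bars K')"
    by (rule agree_bars) (simp add: bK)
  have lowB: "low_odd (bars K) (u i j) = low_odd (bars K') (u' i j)" if "i < 3" "j < 3" "i \<noteq> j" for i j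
    using low_arc_empty[OF B that(1) U(1) U'(1)] bK[OF that(1)] that by simp
  have summand: "summand K (crv K (u i j)) = summand K' (crv K' (u' i j))"
    if ij: "i < 3" "j < 3" "i \<noteq> j" and c: "crv K (u i j) \<in> cls K" for i j
  proof -
    have c': "crv K' (u' i j) \<in> cls K'" using c corr(1) ij by blast
    note V = U(5,3)[OF ij ij(1,2)] U'(5,3)[OF ij ij(1,2)]
    have "cweight K (crv K (u i j)) = cweight K' (crv K' (u' i j))"
      by (rule cweight_cong_low(2)[OF K.tw_diagram_axioms K'.tw_diagram_axioms c c' V])
        (use lowP[OF ij c] lowZ[OF ij] lowB[of i j] lowB[of j i] low_1[OF B] ij in simp_all)
    moreover have "crossing_sign K (crv K (u i j)) = crossing_sign K' (crv K' (u' i j))"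
      using K.crossing_sign_dir[OF c V(1,2)] K'.crossing_sign_dir[OF c' V(3,4)] corr(2,3)[OF ij] by simp
    ultimately show ?thesis by (simp add: summand_def)
  qed
  \<comment> \<open>The condition \<open>i < j\<close> lists every corner once, so that the inner
    sums can be reindexed by the same set for both diagrams.\<close>
  define I where "I = {(i, j). i < j \<and> j < 3 \<and> crv K (u i j) \<in> cls K}"
  have inK: "cls K \<inter> ball z r = (\<lambda>(i, j). crv K (u i j)) ` I"
  proof (intro equalityI subsetI)
    fix d assume d: "d \<in> cls K \<inter> ball z r"
    obtain i j x y where ij: "i < 3" "j < 3" and xy: "(x, y) \<in> meets K (arc i) (arc j)" "d = crv K x"
      using inner_cls[OF d] by metis
    then have "i \<noteq> j" "d = crv K (u i j)" using mK(1)[OF ij] by (auto split: if_splits)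
    then have "(i, j) \<in> I \<or> (j, i) \<in> I" "d = crv K (u j i)" using ij d sym[of i j] by (auto simp: I_def)
    then show "d \<in> (\<lambda>(i, j). crv K (u i j)) ` I" using \<open>d = crv K (u i j)\<close> by force
  next
    fix d assume "d \<in> (\<lambda>(i, j). crv K (u i j)) ` I"
    then show "d \<in> cls K \<inter> ball z r" using U(6) by (auto simp: I_def)
  qed
  have inK': "cls K' \<inter> ball z r = (\<lambda>(i, j). crv K' (u' i j)) ` I"
  proof (intro equalityI subsetI)
    fix d assume d: "d \<in> cls K' \<inter> ball z r"
    obtain i j x y where ij: "i < 3" "j < 3" and xy: "(x, y) \<in> meets K' (arc i) (arc j)" "d = crv K' x"
      using F.inner_cls[OF d] by metis
    then have "i \<noteq> j" "d = crv K' (u' i j)" using mK(2)[OF ij] by (auto split: if_splits)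
    then have "(i, j) \<in> I \<or> (j, i) \<in> I" "d = crv K' (u' j i)"
      using ij d sym[of i j] corr(1)[of i j] by (auto simp: I_def)
    then show "d \<in> (\<lambda>(i, j). crv K' (u' i j)) ` I" using \<open>d = crv K' (u' i j)\<close> by force
  next
    fix d assume "d \<in> (\<lambda>(i, j). crv K' (u' i j)) ` I"
    then obtain i j where "i < j" "j < 3" "crv K (u i j) \<in> cls K" "d = crv K' (u' i j)"
      by (auto simp: I_def)
    then show "d \<in> cls K' \<inter> ball z r" using U'(6)[of i j] corr(1)[of i j] by auto
  qed
  have distinct: "i = k \<and> j = l"
    if ij: "i < j" "j < 3" "k < l" "l < 3"
      and x: "x \<in> arc i" "y \<in> arc j" "x' \<in> arc k" "y' \<in> arc l" "{x, y} = {x', y'}" for i j k l x y x' y'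
  proof -
    have "x = x' \<and> y = y' \<or> x = y' \<and> y = x'" using x(5) by (auto simp: doubleton_eq_iff)
    then show ?thesis
    proof
      assume "x = x' \<and> y = y'"
      then show ?thesis using arc_inj[of i k x] arc_inj[of j l y] ij x by simp
    next
      assume "x = y' \<and> y = x'"
      then show ?thesis using arc_inj[of i l x] arc_inj[of j k y] ij x by simp
    qed
  qed
  have inj_g: "inj_on (\<lambda>(i, j). crv K (u i j)) I"
  proof (rule inj_onI, clarify)
    fix i j k l assume "(i, j) \<in> I" "(k, l) \<in> I" and eq: "crv K (u i j) = crv K (u k l)"
    then have ij: "i < j" "j < 3" "k < l" "l < 3" by (auto simp: I_def)
    have "{u i j, u j i} = {u k l, u l k}" using U(5)[of i j] U(5)[of k l] eq ij by simp
    then show "i = k \<and> j = l"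
      using distinct[OF ij U(1)[of i j] U(2)[of i j] U(1)[of k l] U(2)[of k l]] ij by simp
  qed
  have inj_g': "inj_on (\<lambda>(i, j). crv K' (u' i j)) I"
  proof (rule inj_onI, clarify)
    fix i j k l assume "(i, j) \<in> I" "(k, l) \<in> I" and eq: "crv K' (u' i j) = crv K' (u' k l)"
    then have ij: "i < j" "j < 3" "k < l" "l < 3" by (auto simp: I_def)
    have "{u' i j, u' j i} = {u' k l, u' l k}" using U'(5)[of i j] U'(5)[of k l] eq ij by simp
    then show "i = k \<and> j = l"
      using distinct[OF ij U'(1)[of i j] U'(2)[of i j] U'(1)[of k l] U'(2)[of k l]] ij by simp
  qed
  have "(\<Sum>c\<in>cls K \<inter> ball z r. summand K c) = (\<Sum>c\<in>cls K' \<inter> ball z r. summand K' c)"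
    unfolding inK inK' sum.reindex[OF inj_g] sum.reindex[OF inj_g']
    by (rule sum.cong[OF refl]) (auto simp: I_def intro!: summand)
  then show ?thesis by (rule Qz_eq_of_inner[OF P Z B])
qed

section \<open>Invariance and Gordian distance\<close>

lemma Qz_reidemeister:
  assumes "reidemeister K K'"
  shows "Qz K = Qz K'"
proof -
  have tw: "twisted_diagram K" "twisted_diagram K'"
    using assms by (auto simp: reidemeister_def)
  consider "isotopic K K'" | cl where "move1 cl K K'" | cl where "move2 cl K K'" | "move_C3 K K'"
    | "move_V3 K K'" | "move_V4 K K'" | "move_T1 K K'" | "move_T2 K K'" | "move_T3 K K'"
    using assms unfolding reidemeister_def by blast
  then show ?thesis
  proof cases
    case 4
    then obtain u u' where t: "triangle_move u u' K K'"
      and c: "\<forall>i<3. \<forall>j<3. i \<noteq> j \<longrightarrow> crv K (u i j) \<in> cls K"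
      unfolding move_C3_def by blast
    show ?thesis by (rule Qz_triangle_move[OF tw t]) (use c in simp)
  next
    case 5
    then obtain u u' where t: "triangle_move u u' K K'"
      and c: "\<forall>i<3. \<forall>j<3. i \<noteq> j \<longrightarrow> crv K (u i j) \<notin> cls K"
      unfolding move_V3_def by blast
    show ?thesis by (rule Qz_triangle_move[OF tw t]) (use c in simp)
  next
    case 6
    then obtain u u' where t: "triangle_move u u' K K'"
      and c: "crv K (u 2 0) \<notin> cls K" "crv K (u 2 1) \<notin> cls K"
      unfolding move_V4_def by blast
    from t obtain a b where "triangle a b u K"
      unfolding triangle_move_def by (elim conjE exE) (rule that; assumption)
    then have meets: "(u i j, u j i) \<in> meets K {a i<..<b i} {a j<..<b j}" if "i < 3" "j < 3" "i \<noteq> j" for i j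
      using that unfolding triangle_def by simp
    have sym: "crv K (u j i) = crv K (u i j)" if "i < 3" "j < 3" "i \<noteq> j" for i j
      using meets[OF that] unfolding meets_def by simp
    have 2: "crv K (u 2 l) \<notin> cls K" "crv K (u l 2) \<notin> cls K" if "l < 3" "l \<noteq> 2" for l
    proof -
      have "l = 0 \<or> l = 1" using that by presburger
      then show "crv K (u 2 l) \<notin> cls K" using c by blast
      then show "crv K (u l 2) \<notin> cls K" using sym[of l 2] that by simp
    qed
    show ?thesis
    proof (rule Qz_triangle_move[OF tw t])
      fix i j k :: nat
      assume ijk: "i < 3" "j < 3" "k < 3" "i \<noteq> j" "j \<noteq> k" "i \<noteq> k"
        and cls: "crv K (u i j) \<in> cls K" "crv K (u i k) \<in> cls K"
      \<comment> \<open>The two crossings in the premises are different corners, and at least one of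
        them lies on arc 2, where all crossings are virtual: the premises contradict each
        other.\<close>
      then have "i = 2 \<or> j = 2 \<or> k = 2" by presburger
      then show "crv K (u j k) \<in> cls K" using 2[of i] 2[of j] 2[of k] ijk cls by auto
    qed
  qed (use tw Qz_isotopic Qz_move1 Qz_move2 Qz_move_T1 Qz_move_T2 Qz_move_T3 in blast)+
qed

lemma Qz_symclp: "symclp reidemeister K K' \<Longrightarrow> Qz K = Qz K'"
  using Qz_reidemeister by (metis symclpE)

lemma Qz_equivclp: "equivclp reidemeister K K' \<Longrightarrow> Qz K = Qz K'"
  unfolding equivclp_def by (induction rule: rtranclp_induct) (auto dest: Qz_symclp)

lemma Qz_twisted_knot:
  assumes "K \<in> twisted_knots" "D \<in> K" "E \<in> K"
  shows "Qz D = Qz E"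
proof -
  obtain x where "K = {(D, D'). twisted_diagram D \<and> twisted_diagram D' \<and> equivclp reidemeister D D'} `` {x}"
    using assms(1) unfolding twisted_knots_def by (rule quotientE)
  then have "equivclp reidemeister x D" "equivclp reidemeister x E" using assms(2,3) by auto
  then show ?thesis using Qz_equivclp by metis
qed

text \<open>Every crossing change contributes exactly one term and every Reidemeister move, in
  either direction, contributes none. That \<open>D'\<close> is again a diagram is part of the
  induction because \<open>crossing_change\<close> does not say so by itself.\<close>

lemma transforms_Qz:
  assumes "transforms n D D'"
  shows "twisted_diagram D' \<and> (\<exists>(a :: nat \<Rightarrow> int) b p q.
    (\<forall>i\<in>{1..n}. a i \<in> {-1, 1} \<and> b i \<in> {0, 1} \<and> p i \<in> {0, 1} \<and> q i \<in> {0, 1}) \<and>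
    Qz D - Qz D' = (\<Sum>i=1..n. 2 * of_int (a i) * wt (b i) (p i) (q i)))"
  using assms
proof (induction rule: transforms.induct)
  case (start D)
  then show ?case by simp
next
  case (move n D E F)
  have "Qz E = Qz F" using Qz_symclp move.hyps(2) .
  moreover have "twisted_diagram F" using move.hyps(2) by (auto simp: symclp_def reidemeister_def)
  ultimately show ?case using move.IH by simp
next
  case (change n D E F)
  have E: "twisted_diagram E" using change.IH by blast
  obtain a :: "nat \<Rightarrow> int" and b p q where
    r: "\<forall>i\<in>{1..n}. a i \<in> {-1, 1} \<and> b i \<in> {0, 1} \<and> p i \<in> {0, 1} \<and> q i \<in> {0, 1}"
    and s: "Qz D - Qz E = (\<Sum>i=1..n. 2 * of_int (a i) * wt (b i) (p i) (q i))"
    using change.IH by blast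
  obtain a' :: int and b' p' q' where
    r': "a' \<in> {-1, 1}" "b' \<in> {0, 1}" "p' \<in> {0, 1}" "q' \<in> {0, 1}"
    and s': "Qz E - Qz F = 2 * of_int a' * wt b' p' q'"
    using Qz_crossing_change[OF E change.hyps(2)] by blast
  \<comment> \<open>The term of the new crossing change is stored at index
    \<open>Suc n\<close>.\<close>
  let ?a = "a(Suc n := a')" and ?b = "b(Suc n := b')" and ?p = "p(Suc n := p')" and ?q = "q(Suc n := q')"
  have "Qz D - Qz F = (\<Sum>i=1..n. 2 * of_int (a i) * wt (b i) (p i) (q i)) + 2 * of_int a' * wt b' p' q'"
    using s s' by simp
  also have "(\<Sum>i=1..n. 2 * of_int (a i) * wt (b i) (p i) (q i)) =
      (\<Sum>i=1..n. 2 * of_int (?a i) * wt (?b i) (?p i) (?q i))"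
    by (rule sum.cong) auto
  finally have "Qz D - Qz F = (\<Sum>i=1..Suc n. 2 * of_int (?a i) * wt (?b i) (?p i) (?q i))" by simp
  moreover have "\<forall>i\<in>{1..Suc n}. ?a i \<in> {-1, 1} \<and> ?b i \<in> {0, 1} \<and> ?p i \<in> {0, 1} \<and> ?q i \<in> {0, 1}"
    using r r' by (auto simp: le_Suc_eq)
  ultimately show ?case using crossing_change_twisted[OF E change.hyps(2)] by blast
qed

theorem mainTheorem5:
  fixes K K' :: "tdiag set" and D D' :: tdiag
  assumes "K \<in> twisted_knots" and "K' \<in> twisted_knots" and "homotopic_knots K K'"
    and "D \<in> K" and "D' \<in> K'"
  shows "\<exists>(m::nat) (a :: nat \<Rightarrow> int) (b :: nat \<Rightarrow> nat) (p0 :: nat \<Rightarrow> nat) (p1 :: nat \<Rightarrow> nat).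
    (\<forall>i\<in>{1..m}. a i \<in> {-1, 1} \<and> b i \<in> {0, 1} \<and> p0 i \<in> {0, 1} \<and> p1 i \<in> {0, 1}) \<and>
    Qz D - Qz D' =
      (\<Sum>i=1..m. 2 * of_int (a i) *
         (var_s ^ b i * var_t ^ p0 i - 1) * (var_s ^ b i * var_t ^ p1 i - 1)) \<and>
    (\<Sum>i=1..m. \<bar>a i\<bar>) \<le> int (gordian_dist K K')"
proof -
  \<comment> \<open>One term for each crossing change of a shortest sequence. All coefficients have
    absolute value 1, so the required bound even holds with equality.\<close>
  let ?m = "gordian_dist K K'"
  have "\<exists>n. \<exists>D\<in>K. \<exists>D'\<in>K'. transforms n D D'"
    using assms(3) unfolding homotopic_knots_def by blast
  \<comment> \<open>The minimum is attained at representatives \<open>E\<close> and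
    \<open>E'\<close> that need not be \<open>D\<close> and \<open>D'\<close>; invariance of
    \<open>Qz\<close> within a knot carries the formula over.\<close>
  from LeastI_ex[OF this] obtain E E' where E: "E \<in> K" "E' \<in> K'" "transforms ?m E E'"
    unfolding gordian_dist_def by blast
  from transforms_Qz[OF E(3)] obtain a :: "nat \<Rightarrow> int" and b p q where
    r: "\<forall>i\<in>{1..?m}. a i \<in> {-1, 1} \<and> b i \<in> {0, 1} \<and> p i \<in> {0, 1} \<and> q i \<in> {0, 1}"
    and s: "Qz E - Qz E' = (\<Sum>i=1..?m. 2 * of_int (a i) * wt (b i) (p i) (q i))"
    by blast
  have "Qz D - Qz D' = (\<Sum>i=1..?m. 2 * of_int (a i) *
         (var_s ^ b i * var_t ^ p i - 1) * (var_s ^ b i * var_t ^ q i - 1))"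
    using s Qz_twisted_knot[OF assms(1,4) E(1)] Qz_twisted_knot[OF assms(2,5) E(2)]
    by (simp add: wt_def mult.assoc)
  moreover have "(\<Sum>i=1..?m. \<bar>a i\<bar>) = (\<Sum>i=1..?m. 1)"
  proof (rule sum.cong[OF refl])
    fix i assume "i \<in> {1..?m}"
    then have "a i = - 1 \<or> a i = 1" using r by blast
    then show "\<bar>a i\<bar> = 1" by auto
  qed
  then have "(\<Sum>i=1..?m. \<bar>a i\<bar>) \<le> int ?m" by simp
  ultimately show ?thesis using r by blast
qed

end
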